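(* Let $\alpha\in(0,1)$ and let $\phi_{\mathrm{CvM}}=\mathbf 1(U_{\mathrm{CvM}}>c_{\alpha,\mathrm{CvM}})$, where $c_{\alpha,\mathrm{CvM}}$ is the $\alpha$ level permutation critical value of $U_{\mathrm{CvM}}$. For a sufficiently large $c>0$, let $$\epsilon^\star_{m,n}=c\left(\frac1{\sqrt m}+\frac1{\sqrt n}\right).$$ Then there exists $\zeta\in(0,1-\alpha)$ such that the type II error of $\phi_{\mathrm{CvM}}$ is uniformly bounded by $\zeta$, i.e. $$\sup_{(P_X,P_Y)\in\mathcal F(\epsilon^\star_{m,n})}\mathbb{P}_1(\phi_{\mathrm{CvM}}=0)<\zeta .$$
   Context: Data: $\mathcal X_m=\{X_1,\dots,X_m\}$ i.i.d. from $P_X$ and, independently, $\mathcal Y_n=\{Y_1,\dots,Y_n\}$ i.i.d. from $P_Y$ on $\mathbb{R}^d$, $m,n\ge2$, $N=m+n$; no assumption on the ratio $m/n$. All pairs considered satisfy the standing assumption that $\beta^\top X$ and $\beta^\top Y$ ($X\sim P_X$, $Y\sim P_Y$) have continuous distribution functions for $\lambda$-almost all $\beta\in\mathbb{S}^{d-1}$, $\lambda$ being the uniform probability measure on the unit sphere. $\mathbb{P}_1$ is the probability when the data come from $(P_X,P_Y)$. CvM-distance: $W_d\ge0$ with $$W_d^2(P_X,P_Y)=\int_{\mathbb{S}^{d-1}}\int_{\mathbb{R}}\big(F_{\beta^\top X}(t)-F_{\beta^\top Y}(t)\big)^2\,d\{\vartheta_XF_{\beta^\top X}(t)+\vartheta_YF_{\beta^\top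 Y}(t)\}\,d\lambda(\beta),$$ $F_{\beta^\top X}$ the distribution function of $\beta^\top X$, $\vartheta_X\in(0,1)$ fixed, $\vartheta_Y=1-\vartheta_X$. $\mathcal F(\epsilon)=\{(P_X,P_Y):W_d(P_X,P_Y)\ge\epsilon\}$. Statistic: $\mathsf{Ang}(u,v)=\arccos\{u^\top v/(\|u\|\|v\|)\}$, $$h_{\mathrm{CvM}}(x_1,x_2;y_1,y_2)=\tfrac13-\tfrac1{2\pi}\mathsf{Ang}(x_1-y_1,x_2-y_1)-\tfrac1{2\pi}\mathsf{Ang}(y_1-x_1,y_2-x_1),$$ $$U_{\mathrm{CvM}}=\frac1{m(m-1)n(n-1)}\sum_{i_1\ne i_2}\sum_{j_1\neq j_2}h_{\mathrm{CvM}}(X_{i_1},X_{i_2};Y_{j_1},Y_{j_2}).$$ Permutation critical value: with pooled sample $(Z_1,\dots,Z_N)=(X_1,\dots,X_m,Y_1,\dots,Y_n)$, $c_{\alpha,\mathrm{CvM}}=\inf\{t:1-\alpha\le\frac1{N!}\sum_{\varpi}\mathbf 1(U_{\mathrm{CvM}}(Z_\varpi)\le t)\}$, the sum over all permutations $\varpi$ of $\{1,\dots,N\}$, where $U_{\mathrm{CvM}}(Z_\varpi)$ is computed with first sample $Z_{\varpi(1)},\dots,Z_{\varpi(m)}$ and second sample $Z_{\varpi(m+1)},\dots,Z_{\varpi(N)}$. *)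

theory Defs
  imports "HOL-Probability.Probability"
begin

text \<open>
  The uniform probability measure on the unit sphere is the law of \<open>x / norm x\<close> for \<open>x\<close> uniform
  in the unit ball.  It is a Borel measure on the whole space, carried by \<open>sphere 0 1\<close>.
\<close>

definition unif_sphere :: "'a::euclidean_space measure" where
  "unif_sphere = distr (uniform_measure lborel (ball 0 1)) borel sgn"

definition proj_cdf :: "'a::euclidean_space measure \<Rightarrow> 'a \<Rightarrow> real \<Rightarrow> real" where
  "proj_cdf P \<beta> = cdf (distr P borel (\<lambda>x. \<beta> \<bullet> x))"

definition continuous_projections :: "'a::euclidean_space measure \<Rightarrow> bool" where
  "continuous_projections P \<longleftrightarrow> (AE \<beta> in unif_sphere. continuous_on UNIV (proj_cdf P \<beta>))"

definition CvM_dist :: "real \<Rightarrow> 'a::euclidean_space measure \<Rightarrow> 'a measure \<Rightarrow> real" where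
  "CvM_dist \<theta> P Q = sqrt (\<integral>\<beta>. (\<integral>t. (proj_cdf P \<beta> t - proj_cdf Q \<beta> t)\<^sup>2
      \<partial>interval_measure (\<lambda>t. \<theta> * proj_cdf P \<beta> t + (1 - \<theta>) * proj_cdf Q \<beta> t)) \<partial>unif_sphere)"

definition CvM_alternatives ::
    "real \<Rightarrow> real \<Rightarrow> ('a::euclidean_space measure \<times> 'a measure) set" where
  "CvM_alternatives \<theta> \<epsilon> = {(P, Q).
      prob_space P \<and> sets P = sets borel \<and> continuous_projections P \<and>
      prob_space Q \<and> sets Q = sets borel \<and> continuous_projections Q \<and>
      CvM_dist \<theta> P Q \<ge> \<epsilon>}"

text \<open>If \<open>u = 0\<close> or \<open>v = 0\<close> the quotient is \<open>0\<close> and the angle is \<open>pi / 2\<close>.\<close>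

definition Ang :: "'a::euclidean_space \<Rightarrow> 'a \<Rightarrow> real" where
  "Ang u v = arccos ((u \<bullet> v) / (norm u * norm v))"

definition h_CvM :: "'a::euclidean_space \<Rightarrow> 'a \<Rightarrow> 'a \<Rightarrow> 'a \<Rightarrow> real" where
  "h_CvM x1 x2 y1 y2 =
     1 / 3 - 1 / (2 * pi) * Ang (x1 - y1) (x2 - y1) - 1 / (2 * pi) * Ang (y1 - x1) (y2 - x1)"

text \<open>
  Indices start at \<open>0\<close>.  A pooled sample is a function \<open>z\<close> on \<open>{..<m+n}\<close>: the first sample is
  \<open>z 0, \<dots>, z (m - 1)\<close> and the second is \<open>z m, \<dots>, z (m + n - 1)\<close>.
\<close>

definition U_CvM :: "nat \<Rightarrow> nat \<Rightarrow> (nat \<Rightarrow> 'a::euclidean_space) \<Rightarrow> real" where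
  "U_CvM m n z = 1 / (real m * (real m - 1) * real n * (real n - 1)) *
     (\<Sum>i1<m. \<Sum>i2\<in>{..<m} - {i1}. \<Sum>j1<n. \<Sum>j2\<in>{..<n} - {j1}.
        h_CvM (z i1) (z i2) (z (m + j1)) (z (m + j2)))"

definition crit_CvM :: "real \<Rightarrow> nat \<Rightarrow> nat \<Rightarrow> (nat \<Rightarrow> 'a::euclidean_space) \<Rightarrow> real" where
  "crit_CvM \<alpha> m n z = Inf {t. 1 - \<alpha> \<le>
     1 / fact (m + n) * (\<Sum>\<pi> | \<pi> permutes {..<m + n}. of_bool (U_CvM m n (\<lambda>i. z (\<pi> i)) \<le> t))}"

definition test_CvM :: "real \<Rightarrow> nat \<Rightarrow> nat \<Rightarrow> (nat \<Rightarrow> 'a::euclidean_space) \<Rightarrow> nat" where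
  "test_CvM \<alpha> m n z = of_bool (U_CvM m n z > crit_CvM \<alpha> m n z)"

definition pooled_law ::
    "nat \<Rightarrow> nat \<Rightarrow> 'a::euclidean_space measure \<Rightarrow> 'a measure \<Rightarrow> (nat \<Rightarrow> 'a) measure" where
  "pooled_law m n P Q = PiM {..<m + n} (\<lambda>i. if i < m then P else Q)"

definition type2_error_CvM ::
    "real \<Rightarrow> nat \<Rightarrow> nat \<Rightarrow> 'a::euclidean_space measure \<Rightarrow> 'a measure \<Rightarrow> ennreal" where
  "type2_error_CvM \<alpha> m n P Q =
     emeasure (pooled_law m n P Q) {z \<in> space (pooled_law m n P Q). test_CvM \<alpha> m n z = 0}"

end

theory Submission
  imports Defs "HOL-Combinatorics.Permutations"
begin

text \<open>
  Averaged over the direction, \<open>U_CvM\<close> agrees up to \<open>O(1/m + 1/n)\<close> with half of the nonnegative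
  V-statistic \<open>V = \<integral>\<integral> (F\<^sub>m - G\<^sub>n)\<^sup>2 d(F\<^sub>m + G\<^sub>n) d\<lambda>\<close> built from the empirical distribution functions of
  the projections; this uses \<open>\<lambda>{\<beta>. \<beta> \<bullet> u \<le> 0 \<and> \<beta> \<bullet> v \<le> 0} = 1/2 - Ang u v / (2\<pi>)\<close> and the fact that
  exactly one of three projections is the largest. Since \<open>V \<ge> 0\<close>, first moments suffice: the mean of \<open>V\<close>
  over all permutations is \<open>O(1/m + 1/n)\<close>, so by Markov's inequality the critical value is as well.
  Under the alternative, \<open>V\<close> is bounded below through the triangle inequality in \<open>L\<^sup>2\<close> of the pooled
  empirical measure: the error of the empirical distribution functions has mean square \<open>O(1/m + 1/n)\<close>,
  while \<open>\<integral>\<integral> (F - G)\<^sup>2 d(F\<^sub>m + G\<^sub>n) d\<lambda>\<close> is a sum of independent terms with values in \<open>[0, 1]\<close> and hence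
  concentrates around its mean, which is at least \<open>W\<^sup>2 \<ge> c\<^sup>2 (1/m + 1/n)\<close>.
\<close>

section \<open>Wedges and the uniform measure on the sphere\<close>

text \<open>No relation between m and n is assumed, so each sample keeps its own normalisation and
  every error is measured in \<open>1/m + 1/n\<close>. For the same reason \<open>W\<^sup>2\<close>
  is replaced at once by the integral of the squared gap against \<open>P + Q\<close>: this removes
  \<theta> and fits the weights of V. The squared radius is at least
  \<open>c\<^sup>2 (1/m + 1/n)\<close>, so fixed factors lost on the way are absorbed by c.

  The critical estimate is the concentration. A variance of order \<open>1/m + 1/n\<close> is too
  weak for Chebyshev's inequality when the mean T is itself only of order
  \<open>c (1/m + 1/n)\<close>. Because the terms lie in \<open>[0, 1]\<close>, the variance also
  carries the factor T, and the exceptional probability becomes of order 1/c.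

  Ties are the other obstacle: \<open>Ang\<close> has the default value \<open>pi / 2\<close> at the
  zero vector, where the angular formula fails. One continuous projection already excludes atoms, so
  ties have probability zero, and on distinct points the comparison of U with V holds for every
  permutation.\<close>

definition wedge :: "'a::euclidean_space \<Rightarrow> 'a \<Rightarrow> 'a set" where
  "wedge u v = {x. norm x < 1 \<and> 0 < x \<bullet> u \<and> x \<bullet> v < 0}"

lemma open_wedge: "open (wedge u v)"
  unfolding wedge_def by (intro open_Collect_conj open_Collect_less continuous_intros)

lemma wedge_borel [measurable]: "wedge u v \<in> sets borel"
  by (simp add: open_wedge borel_open)

lemma lmeasurable_wedge [simp]: "wedge u v \<in> lmeasurable"
proof (rule lmeasurable_open[OF _ open_wedge])
  show "bounded (wedge u v)"
    by (rule bounded_subset[of "ball 0 1"]) (auto simp: wedge_def)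
qed

lemma wedge_scaleR: "0 < r \<Longrightarrow> 0 < s \<Longrightarrow> wedge (r *\<^sub>R u) (s *\<^sub>R v) = wedge u v"
  by (auto simp: wedge_def zero_less_mult_iff mult_less_0_iff)

lemma wedge_same [simp]: "wedge u u = {}"
  by (auto simp: wedge_def)

lemma measure_Un_almost:
  assumes "S \<in> lmeasurable" "T \<in> lmeasurable" "S \<inter> T = {}" "negligible N"
    and "S \<union> T \<subseteq> W" "W \<subseteq> S \<union> T \<union> N"
  shows "measure lebesgue W = measure lebesgue S + measure lebesgue T"
proof -
  have "negligible (W - (S \<union> T) \<union> ((S \<union> T) - W))"
    by (rule negligible_subset[OF assms(4)]) (use assms in auto)
  then have "measure lebesgue W = measure lebesgue (S \<union> T)"
    using measure_negligible_symdiff[of "S \<union> T" W] fmeasurable.Un[OF assms(1,2)]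
    by (simp only: Un_commute)
  then show ?thesis
    using measure_Un3[of S lebesgue T] assms by (simp add: fmeasurable.Un)
qed

section \<open>Invariance of Lebesgue measure under orthogonal maps\<close>

lemma emeasure_unit_ball: "emeasure lborel (ball (0 :: 'a::euclidean_space) 1) \<noteq> 0"
  "emeasure lborel (ball (0 :: 'a::euclidean_space) 1) \<noteq> \<infinity>"
  using emeasure_lborel_ball_finite[of "0 :: 'a" 1] content_ball_pos[of 1 "0 :: 'a"]
  by (auto simp: measure_def)

text \<open>The uniqueness argument for Haar measure: \<open>\<mu> A * \<lambda> B = \<mu> B * \<lambda> A\<close> for the image
  measure \<open>\<mu>\<close>, and \<open>\<mu>\<close> agrees with \<open>\<lambda>\<close> on the unit ball.\<close>

lemma distr_lborel_orthogonal:
  fixes f :: "'a::euclidean_space \<Rightarrow> 'a"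
  assumes f: "orthogonal_transformation f"
  shows "distr lborel borel f = lborel"
proof -
  have lin: "linear f" by (rule orthogonal_transformation_linear[OF f])
  then have [measurable]: "f \<in> borel_measurable borel"
    by (intro borel_measurable_continuous_onI linear_continuous_on linear_conv_bounded_linear[THEN iffD1])
  define B :: "'a set" where "B = ball 0 1"
  have [measurable]: "B \<in> sets borel" by (simp add: B_def)
  have lam: "emeasure lborel {y. x - y \<in> A} = emeasure lborel A"
    if [measurable]: "A \<in> sets borel" for A :: "'a set" and x
  proof -
    have "lborel = distr (lborel :: 'a measure) borel (\<lambda>y. x - y)"
      using lborel_affine[of "-1" x] by (simp add: density_1)
    then have "emeasure lborel A = emeasure (distr lborel borel (\<lambda>y. x - y)) A"
      by simp
    then show ?thesis by (simp add: emeasure_distr vimage_def)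
  qed
  have lamp: "emeasure lborel {y. x + y \<in> A} = emeasure lborel A"
    if [measurable]: "A \<in> sets borel" for A :: "'a set" and x
  proof -
    have "emeasure lborel A = emeasure (distr lborel borel (\<lambda>y. x + y)) A"
      by (simp add: lborel_distr_plus)
    then show ?thesis by (simp add: emeasure_distr vimage_def)
  qed
  have mu: "emeasure lborel {x. f x - y \<in> A \<and> f x \<in> B} = emeasure lborel {x. f x \<in> A \<and> f x + y \<in> B}"
    if [measurable]: "A \<in> sets borel" for A y
  proof -
    \<comment> \<open>Surjectivity rewrites the shift by y after f as a shift by y' before f;
      translation invariance of the image measure thus reduces to that of
      \<open>lborel\<close>.\<close>
    obtain y' where y': "y = f y'"
      using orthogonal_transformation_surj[OF f] by (metis surjD)
    have "lborel = distr (lborel :: 'a measure) borel (\<lambda>x. y' + x)"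
      using lborel_distr_plus[of y'] by simp
    then have "emeasure lborel {x. f x - y \<in> A \<and> f x \<in> B} =
      emeasure (distr lborel borel (\<lambda>x. y' + x)) {x. f x - y \<in> A \<and> f x \<in> B}"
      by simp
    also have "\<dots> = emeasure lborel {x. f x \<in> A \<and> f x + y \<in> B}"
      by (subst emeasure_distr)
        (auto simp: y' linear_add[OF lin] add.commute intro!: arg_cong[where f = "emeasure lborel"])
    finally show ?thesis .
  qed
  \<comment> \<open>The integral of \<open>indicator A (f x) * indicator B (f x + y)\<close> over x
    and y, evaluated in two ways. Integrating y first leaves the volume of B; moving the shift to A
    with \<open>mu\<close> and then integrating y leaves the volume of A.\<close>
  have sym: "emeasure lborel {x. f x \<in> A} * emeasure lborel B =
      emeasure lborel {x. f x \<in> B} * emeasure lborel A"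
    if A[measurable]: "A \<in> sets borel" for A
  proof -
    have "emeasure lborel {x. f x \<in> A} * emeasure lborel B =
        (\<integral>\<^sup>+x. indicator {x. f x \<in> A} x * emeasure lborel B \<partial>lborel)"
      by (subst nn_integral_multc) auto
    also have "\<dots> = (\<integral>\<^sup>+x. (\<integral>\<^sup>+y. indicator A (f x) * indicator B (f x + y) \<partial>lborel) \<partial>lborel)"
    proof (rule nn_integral_cong)
      fix x
      have "(\<integral>\<^sup>+y. indicator {y. f x + y \<in> B} y \<partial>lborel) = emeasure lborel {y. f x + y \<in> B}"
        by (rule nn_integral_indicator) measurable
      then show "indicator {x. f x \<in> A} x * emeasure lborel B =
          (\<integral>\<^sup>+y. indicator A (f x) * indicator B (f x + y) \<partial>lborel)"
        using lamp[of B "f x"] by (simp add: nn_integral_cmult indicator_def)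
    qed
    also have "\<dots> = (\<integral>\<^sup>+y. (\<integral>\<^sup>+x. indicator A (f x) * indicator B (f x + y) \<partial>lborel) \<partial>lborel)"
      by (rule lborel_pair.Fubini') measurable
    also have "\<dots> = (\<integral>\<^sup>+y. (\<integral>\<^sup>+x. indicator {x. f x \<in> A \<and> f x + y \<in> B} x \<partial>lborel) \<partial>lborel)"
      by (intro nn_integral_cong) (simp add: indicator_def)
    also have "\<dots> = (\<integral>\<^sup>+y. (\<integral>\<^sup>+x. indicator {x. f x - y \<in> A \<and> f x \<in> B} x \<partial>lborel) \<partial>lborel)"
      using mu[OF A] by (subst (1 2) nn_integral_indicator) auto
    also have "\<dots> = (\<integral>\<^sup>+y. (\<integral>\<^sup>+x. indicator A (f x - y) * indicator B (f x) \<partial>lborel) \<partial>lborel)"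
      by (intro nn_integral_cong) (simp add: indicator_def)
    also have "\<dots> = (\<integral>\<^sup>+x. (\<integral>\<^sup>+y. indicator A (f x - y) * indicator B (f x) \<partial>lborel) \<partial>lborel)"
      by (rule lborel_pair.Fubini') measurable
    also have "\<dots> = (\<integral>\<^sup>+x. indicator {x. f x \<in> B} x * emeasure lborel A \<partial>lborel)"
    proof (rule nn_integral_cong)
      fix x
      have "(\<integral>\<^sup>+y. indicator {y. f x - y \<in> A} y \<partial>lborel) = emeasure lborel {y. f x - y \<in> A}"
        by (rule nn_integral_indicator) measurable
      then show "(\<integral>\<^sup>+y. indicator A (f x - y) * indicator B (f x) \<partial>lborel) =
          indicator {x. f x \<in> B} x * emeasure lborel A"
        using lam[OF A, of "f x"] by (simp add: nn_integral_multc indicator_def)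
    qed
    also have "\<dots> = emeasure lborel {x. f x \<in> B} * emeasure lborel A"
      by (subst nn_integral_multc) auto
    finally show ?thesis .
  qed
  have B: "emeasure lborel {x. f x \<in> B} = emeasure lborel B"
    by (simp add: B_def orthogonal_transformation_norm[OF f] ball_def dist_norm)
  have fin: "emeasure lborel B \<noteq> 0" "emeasure lborel B \<noteq> \<infinity>"
    unfolding B_def by (rule emeasure_unit_ball)+
  show ?thesis
  proof (rule measure_eqI)
    fix A assume "A \<in> sets (distr (lborel :: 'a measure) borel f)"
    then have [measurable]: "A \<in> sets borel" by simp
    have "emeasure lborel {x. f x \<in> A} = emeasure lborel A"
      using sym[of A] B fin by (simp add: mult.commute[of _ "emeasure lborel B"] ennreal_mult_cancel_left)
    then show "emeasure (distr lborel borel f) A = emeasure lborel A"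
      by (simp add: emeasure_distr vimage_def)
  qed simp
qed

lemma measure_wedge_orthogonal:
  fixes f :: "'a::euclidean_space \<Rightarrow> 'a"
  assumes f: "orthogonal_transformation f"
  shows "measure lebesgue (wedge (f u) (f v)) = measure lebesgue (wedge u v)"
proof -
  have "linear f" by (rule orthogonal_transformation_linear[OF f])
  then have [measurable]: "f \<in> borel_measurable borel"
    by (intro borel_measurable_continuous_onI linear_continuous_on linear_conv_bounded_linear[THEN iffD1])
  have "measure lborel (wedge (f u) (f v)) = measure (distr lborel borel f) (wedge (f u) (f v))"
    by (simp add: distr_lborel_orthogonal[OF f])
  also have "\<dots> = measure lborel (f -` wedge (f u) (f v))"
    by (subst measure_distr) auto
  also have "f -` wedge (f u) (f v) = wedge u v"
    using f by (auto simp: wedge_def orthogonal_transformation_norm orthogonal_transformation_def)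
  finally show ?thesis by (simp add: measure_completion)
qed

text \<open>\<open>wedge u (- u)\<close> is an open half ball. Negation exchanges it with the
  opposite one, and the rest of the ball lies in a null hyperplane.\<close>

lemma measure_wedge_opposite:
  fixes u :: "'a::euclidean_space"
  assumes "u \<noteq> 0"
  shows "measure lebesgue (wedge u (- u)) = measure lebesgue (ball (0 :: 'a::euclidean_space) 1) / 2"
proof -
  have "measure lebesgue (wedge (- u) (- (- u))) = measure lebesgue (wedge u (- u))"
    by (rule measure_wedge_orthogonal[of uminus])
      (simp add: orthogonal_transformation_def linear_uminus)
  moreover have "measure lebesgue (ball (0 :: 'a::euclidean_space) 1) =
      measure lebesgue (wedge u (- u)) + measure lebesgue (wedge (- u) (- (- u)))"
  proof (rule measure_Un_almost[where N = "{x. u \<bullet> x = 0}"])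
    show "negligible {x. u \<bullet> x = 0}" using assms by (simp add: negligible_hyperplane)
  qed (simp_all only: lmeasurable_wedge, auto simp: wedge_def inner_commute)
  ultimately show ?thesis by simp
qed

section \<open>The volume of a wedge as a function of its angle\<close>

definition circ :: "'a::euclidean_space \<Rightarrow> 'a \<Rightarrow> real \<Rightarrow> 'a" where
  "circ e f t = cos t *\<^sub>R e + sin t *\<^sub>R f"

lemma inner_circ: "x \<bullet> circ e f t = cos t * (x \<bullet> e) + sin t * (x \<bullet> f)"
  by (simp add: circ_def inner_add_right)

context
  fixes e f :: "'a::euclidean_space"
  assumes e: "norm e = 1" and f: "norm f = 1" and ef: "e \<bullet> f = 0"
begin

private lemma inners: "e \<bullet> e = 1" "f \<bullet> f = 1" "f \<bullet> e = 0"
  using e f ef by (auto simp: norm_eq_1 inner_commute)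

text \<open>The rotation by s in the plane of e and f. Writing it as the identity plus a correction
  in that plane fixes the orthogonal complement without choosing a basis of it.\<close>

private definition rot :: "real \<Rightarrow> 'a::euclidean_space \<Rightarrow> 'a::euclidean_space" where
  "rot s x = x + ((x \<bullet> e) * (cos s - 1) - (x \<bullet> f) * sin s) *\<^sub>R e
               + ((x \<bullet> e) * sin s + (x \<bullet> f) * (cos s - 1)) *\<^sub>R f"

text \<open>What is left of \<open>rot s v \<bullet> rot s w = v \<bullet> w\<close> once
  \<open>v \<bullet> w\<close> cancels; \<open>(a, b)\<close> and \<open>(p, q)\<close> are the
  coordinates of v and w along e and f.\<close>

private lemma rot_identity:
  fixes a b p q c s :: real
  assumes "c * c = 1 - s * s"
  shows "(a * (c - 1) - b * s) * p + ((a * s + b * (c - 1)) * q +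
    ((p * (c - 1) - q * s) * (a + (a * (c - 1) - b * s)) +
     (p * s + q * (c - 1)) * (b + (a * s + b * (c - 1))))) = 0"
  using assms by algebra

private lemma orthogonal_rot: "orthogonal_transformation (rot s)"
  unfolding orthogonal_transformation_def
proof
  show "linear (rot s)"
    by (rule linearI) (simp_all add: rot_def inner_add_left algebra_simps)
  show "\<forall>v w. rot s v \<bullet> rot s w = v \<bullet> w"
  proof (intro allI)
    fix v w :: "'a::euclidean_space"
    have cs: "cos s * cos s = 1 - sin s * sin s"
      using sin_cos_squared_add[of s] by (simp add: power2_eq_square algebra_simps)
    have "e \<bullet> v = v \<bullet> e" "f \<bullet> v = v \<bullet> f" "e \<bullet> w = w \<bullet> e" "f \<bullet> w = w \<bullet> f"
      by (simp_all add: inner_commute)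
    then show "rot s v \<bullet> rot s w = v \<bullet> w"
      using rot_identity[OF cs, of "v \<bullet> e" "v \<bullet> f" "w \<bullet> e" "w \<bullet> f"]
      unfolding rot_def by (simp add: inner_add_left inner_add_right inners ef)
  qed
qed

private lemma rot_circ: "rot s (circ e f t) = circ e f (s + t)"
  by (simp add: rot_def circ_def inner_add_left inners ef cos_add sin_add algebra_simps)

text \<open>The hyperplane orthogonal to \<open>circ e f s\<close> cuts the large wedge in two, and
  rotation by s carries the wedge between the angles 0 and t onto the second piece. The bound by pi
  makes \<open>sin (s + t)\<close> nonnegative, which the inclusion of the pieces uses.\<close>

private lemma measure_wedge_circ_add:
  assumes "0 < s" "0 < t" "s + t \<le> pi"
  shows "measure lebesgue (wedge e (circ e f (s + t))) =
    measure lebesgue (wedge e (circ e f s)) + measure lebesgue (wedge e (circ e f t))"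
proof -
  let ?c = "circ e f"
  have c0: "?c 0 = e" by (simp add: circ_def)
  have c_ne: "?c s \<noteq> 0"
  proof
    assume "?c s = 0"
    then have "?c s \<bullet> ?c s = 0" by simp
    then show False
      by (simp add: inner_circ) (simp add: circ_def inner_add_left inners ef flip: power2_eq_square)
  qed
  have pos: "0 < sin s" "0 < sin t" "0 \<le> sin (s + t)"
    using assms by (auto intro!: sin_gt_zero sin_ge_zero)
  \<comment> \<open>The middle direction, times a nonnegative factor, is a positive combination of
    the two outer ones, so the signs on a piece force the sign at the remaining outer
    direction.\<close>
  have rel: "(x \<bullet> ?c s) * sin (s + t) = (x \<bullet> e) * sin t + (x \<bullet> ?c (s + t)) * sin s" for x
  proof -
    have cs: "cos s * cos s = 1 - sin s * sin s"
      using sin_cos_squared_add[of s] by (simp add: power2_eq_square algebra_simps)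
    show ?thesis
      unfolding inner_circ sin_add cos_add using cs by algebra
  qed
  have "measure lebesgue (wedge e (?c (s + t))) =
      measure lebesgue (wedge e (?c s)) + measure lebesgue (wedge (?c s) (?c (s + t)))"
  proof (rule measure_Un_almost[where N = "{x. ?c s \<bullet> x = 0}"])
    show "negligible {x. ?c s \<bullet> x = 0}" using c_ne by (simp add: negligible_hyperplane)
    show "wedge e (?c s) \<union> wedge (?c s) (?c (s + t)) \<subseteq> wedge e (?c (s + t))"
    proof
      fix x assume "x \<in> wedge e (?c s) \<union> wedge (?c s) (?c (s + t))"
      then show "x \<in> wedge e (?c (s + t))"
      proof
        assume x: "x \<in> wedge e (?c s)"
        have "(x \<bullet> ?c s) * sin (s + t) \<le> 0" "0 < (x \<bullet> e) * sin t"
          using x pos by (auto simp: wedge_def intro: mult_nonpos_nonneg)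
        then have "(x \<bullet> ?c (s + t)) * sin s < 0"
          using rel[of x] by linarith
        then show ?thesis using x pos by (auto simp: wedge_def mult_less_0_iff)
      next
        assume x: "x \<in> wedge (?c s) (?c (s + t))"
        have "0 \<le> (x \<bullet> ?c s) * sin (s + t)" "(x \<bullet> ?c (s + t)) * sin s < 0"
          using x pos by (auto simp: wedge_def intro: mult_neg_pos)
        then have "0 < (x \<bullet> e) * sin t"
          using rel[of x] by linarith
        then show ?thesis using x pos by (auto simp: wedge_def zero_less_mult_iff)
      qed
    qed
  qed (simp_all only: lmeasurable_wedge, auto simp: wedge_def inner_commute)
  also have "measure lebesgue (wedge (?c s) (?c (s + t))) = measure lebesgue (wedge e (?c t))"
    using measure_wedge_orthogonal[OF orthogonal_rot, of s "?c 0" "?c t"]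
    unfolding rot_circ by (simp add: c0)
  finally show ?thesis .
qed

text \<open>Additivity in the angle determines the measure at rational multiples of \<open>pi\<close>, and
  monotonicity does the rest.\<close>

lemma measure_wedge_circ:
  assumes t: "0 \<le> t" "t \<le> pi"
  shows "measure lebesgue (wedge e (circ e f t)) =
    measure lebesgue (ball (0 :: 'a::euclidean_space) 1) * t / (2 * pi)"
proof -
  define g where "g t = measure lebesgue (wedge e (circ e f t))" for t
  define b where "b = measure lebesgue (ball (0 :: 'a::euclidean_space) 1)"
  have g0: "g 0 = 0" by (simp add: g_def circ_def)
  have e0: "e \<noteq> 0" using e by auto
  have gpi: "g pi = b / 2"
    using measure_wedge_opposite[OF e0] by (simp add: g_def b_def circ_def)
  have add: "g (s + t) = g s + g t" if "0 \<le> s" "0 \<le> t" "s + t \<le> pi" for s t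
    using that measure_wedge_circ_add[of s t] g0
    by (cases "s = 0"; cases "t = 0") (auto simp: g_def)
  have mono: "g s \<le> g t" if "0 \<le> s" "s \<le> t" "t \<le> pi" for s t
    using add[of s "t - s"] that by (simp add: g_def)
  have mult: "g (real k * (pi / n)) = k * g (pi / n)" if "k \<le> n" "0 < n" for k n :: nat
    using that(1)
  proof (induction k)
    case (Suc k)
    have "real k * (pi / n) + pi / n = real (Suc k) * (pi / n)"
      by (simp add: algebra_simps add_divide_distrib)
    moreover have "real (Suc k) * (pi / n) \<le> pi"
      using Suc.prems that(2) by (simp only: times_divide_eq_right divide_le_eq mult.commute[of _ pi])
        (simp add: mult_left_mono)
    ultimately have "g (real (Suc k) * (pi / n)) = g (real k * (pi / n)) + g (pi / n)"
      using add[of "real k * (pi / n)" "pi / n"] by simp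
    then show ?case using Suc by (simp add: algebra_simps)
  qed (simp add: g0)
  have rat: "g (real k * (pi / n)) = real k / n * (b / 2)" if "k \<le> n" "0 < n" for k n :: nat
    using mult[of n n] mult[OF that] that gpi by (simp add: field_simps)
  have b0: "0 \<le> b" by (simp add: b_def)
  have close: "\<bar>g t - t / pi * (b / 2)\<bar> \<le> (b / 2) / real n" if n: "0 < n" for n
  \<comment> \<open>At \<open>t = pi\<close> the grid point to the right would exceed pi, beyond the
    range of additivity. Elsewhere \<open>g t\<close> and its linear candidate are caught between
    the same two grid values, which differ by \<open>(b / 2) / n\<close>.\<close>
  proof (cases "t = pi")
    case True
    have "\<bar>g t - t / pi * (b / 2)\<bar> = 0" using gpi True by simp
    then show ?thesis using b0 by simp
  next
    case False
    define k where "k = nat \<lfloor>t / pi * n\<rfloor>"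
    have k: "real k \<le> t / pi * n" "t / pi * n < real k + 1"
      using t by (auto simp: k_def of_nat_nat floor_le_iff)
    have "real k < n"
      using k(1) t False n by (smt (verit, best) divide_less_eq_1_pos mult_less_cancel_right2
          of_nat_0_less_iff pi_gt_zero)
    then have kn: "Suc k \<le> n" by simp
    have "g (real k * (pi / n)) \<le> g t"
      using k(1) t n by (intro mono) (auto simp: field_simps)
    moreover have "real (Suc k) * (pi / n) \<le> n * (pi / n)"
      using kn by (intro mult_right_mono) auto
    then have "g t \<le> g (real (Suc k) * (pi / n))"
      using k(2) t n by (intro mono) (auto simp: field_simps)
    ultimately have g: "real k / n * (b / 2) \<le> g t" "g t \<le> (real k + 1) / n * (b / 2)"
      using rat[of k n] rat[of "Suc k" n] kn n by (auto simp: add.commute)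
    have "real k / n * (b / 2) \<le> t / pi * (b / 2)" "t / pi * (b / 2) \<le> (real k + 1) / n * (b / 2)"
    proof -
      have *: "real k / n \<le> t / pi" "t / pi \<le> (real k + 1) / n"
        using k n by (simp_all add: pos_le_divide_eq[of "real n"] pos_divide_le_eq[of "real n"])
      show "real k / n * (b / 2) \<le> t / pi * (b / 2)"
        by (rule mult_right_mono[OF *(1)]) (simp add: b0)
      show "t / pi * (b / 2) \<le> (real k + 1) / n * (b / 2)"
        by (rule mult_right_mono[OF *(2)]) (simp add: b0)
    qed
    moreover have "(real k + 1) / n * (b / 2) = real k / n * (b / 2) + (b / 2) / n"
      by (simp add: add_divide_distrib algebra_simps)
    ultimately show ?thesis using g by linarith
  qed
  have "(\<lambda>n. (b / 2) / real n) \<longlonglongrightarrow> 0"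
    by (rule lim_const_over_n)
  then have "\<bar>g t - t / pi * (b / 2)\<bar> \<le> 0"
    by (rule LIMSEQ_le_const) (use close in \<open>auto intro!: exI[of _ 1]\<close>)
  then show ?thesis by (simp add: g_def b_def field_simps)
qed

end

text \<open>Gram-Schmidt writes two independent directions as e and
  \<open>circ e f (arccos r)\<close>; the norm of the residual q is the sine of the angle. Parallel
  directions span no plane and reduce to an empty wedge or a half ball.\<close>

lemma measure_wedge:
  fixes u v :: "'a::euclidean_space"
  assumes "u \<noteq> 0" "v \<noteq> 0"
  shows "measure lebesgue (wedge u v) =
    measure lebesgue (ball (0 :: 'a::euclidean_space) 1) * Ang u v / (2 * pi)"
proof -
  define e where "e = u /\<^sub>R norm u"
  define v' where "v' = v /\<^sub>R norm v"
  define r where "r = e \<bullet> v'"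
  have e: "norm e = 1" and v': "norm v' = 1" using assms by (auto simp: e_def v'_def)
  have r: "-1 \<le> r" "r \<le> 1"
    using Cauchy_Schwarz_ineq2[of e v'] e v' by (auto simp: r_def abs_le_iff)
  have Ang: "Ang u v = arccos r"
    by (simp add: Ang_def r_def e_def v'_def field_simps)
  have W: "wedge u v = wedge e v'"
    unfolding e_def v'_def using assms by (simp add: wedge_scaleR)
  have ee: "e \<bullet> e = 1" "v' \<bullet> v' = 1" using e v' by (auto simp: norm_eq_1)
  consider "v' = e" | "v' = - e" | "v' \<noteq> r *\<^sub>R e"
  proof (cases "v' = r *\<^sub>R e")
    case True
    then have "\<bar>r\<bar> = 1" using e v' by (metis mult.right_neutral norm_scaleR)
    then have "r = 1 \<or> r = -1" by linarith
    then show thesis using True that(1,2) by auto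
  qed (use that in blast)
  then show ?thesis
  proof cases
    case 1
    then show ?thesis unfolding W Ang r_def by (simp add: ee)
  next
    case 2
    have "e \<noteq> 0" using e by auto
    then show ?thesis
      unfolding W Ang r_def 2 measure_wedge_opposite[OF \<open>e \<noteq> 0\<close>] by (simp add: ee)
  next
    case 3
    define q where "q = v' - r *\<^sub>R e"
    define f where "f = q /\<^sub>R norm q"
    have q: "q \<noteq> 0" using 3 by (simp add: q_def)
    have f: "norm f = 1" using q by (simp add: f_def)
    have eq: "e \<bullet> q = 0" by (simp add: q_def inner_diff_right ee r_def)
    then have ef: "e \<bullet> f = 0" by (simp add: f_def)
    have "(norm q)\<^sup>2 = 1 - r\<^sup>2"
      unfolding power2_norm_eq_inner q_def
      by (simp add: inner_diff_left inner_diff_right ee inner_commute[of v' e] power2_eq_square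
          flip: r_def)
    then have "norm q = sqrt (1 - r\<^sup>2)" by (metis norm_ge_zero real_sqrt_unique)
    then have "sin (arccos r) = norm q" using r by (simp add: sin_arccos)
    then have "circ e f (arccos r) = v'"
      using r q by (simp add: circ_def f_def q_def)
    moreover have "0 \<le> arccos r" "arccos r \<le> pi" using r by (auto simp: arccos_lbound arccos_ubound)
    ultimately show ?thesis
      using measure_wedge_circ[OF e f ef, of "arccos r"] unfolding W Ang by simp
  qed
qed

section \<open>The law of a uniform direction\<close>

lemma borel_measurable_sgn_euclidean [measurable]:
  "(sgn :: 'a::euclidean_space \<Rightarrow> 'a) \<in> borel_measurable borel"
  unfolding sgn_div_norm[abs_def] by measurable

lemma prob_space_unif_sphere: "prob_space (unif_sphere :: 'a::euclidean_space measure)"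
  unfolding unif_sphere_def
  by (intro prob_space.prob_space_distr prob_space_uniform_measure emeasure_unit_ball) simp

lemma sets_unif_sphere [simp, measurable_cong]: "sets unif_sphere = sets borel"
  by (simp add: unif_sphere_def)

lemma space_unif_sphere [simp]: "space unif_sphere = UNIV"
  by (simp add: unif_sphere_def)

lemma measure_unif_sphere:
  assumes [measurable]: "A \<in> sets borel"
  shows "measure unif_sphere A =
    measure lebesgue {x :: 'a::euclidean_space. norm x < 1 \<and> sgn x \<in> A} / measure lebesgue (ball (0 :: 'a) 1)"
proof -
  have "measure unif_sphere A = measure (uniform_measure lborel (ball 0 1)) (sgn -` A)"
    unfolding unif_sphere_def by (subst measure_distr) auto
  also have "\<dots> = measure lborel (ball 0 1 \<inter> sgn -` A) / measure lborel (ball (0 :: 'a) 1)"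
    by (rule measure_uniform_measure)
      (use emeasure_unit_ball[where 'a = 'a] in \<open>auto simp: borel_measurable_sgn_euclidean[THEN measurable_sets_borel]\<close>)
  also have "ball 0 1 \<inter> sgn -` A = {x. norm x < 1 \<and> sgn x \<in> A}"
    by auto
  finally show ?thesis by (simp add: measure_completion)
qed

lemma sgn_inner_less_0_iff: "sgn x \<bullet> u < 0 \<longleftrightarrow> x \<bullet> u < 0"
  by (cases "x = 0") (auto simp: sgn_div_norm mult_less_0_iff zero_less_mult_iff)

lemma sgn_inner_eq_0_iff: "sgn x \<bullet> u = 0 \<longleftrightarrow> x \<bullet> u = 0"
  by (auto simp: sgn_div_norm)

lemma AE_unif_sphere_inner:
  fixes u :: "'a::euclidean_space"
  assumes "u \<noteq> 0"
  shows "AE \<beta> in unif_sphere. \<beta> \<bullet> u \<noteq> 0"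
proof -
  interpret prob_space "unif_sphere :: 'a measure" by (rule prob_space_unif_sphere)
  have "negligible {x. norm x < 1 \<and> x \<bullet> u = 0}"
    by (rule negligible_subset[OF negligible_hyperplane[of u 0]])
      (use assms in \<open>auto simp: inner_commute\<close>)
  then have "measure lebesgue {x. norm x < 1 \<and> x \<bullet> u = 0} = 0"
    by (rule negligible_imp_measure0)
  then have "measure unif_sphere {\<beta>. \<beta> \<bullet> u = 0} = 0"
    by (subst measure_unif_sphere) (simp_all add: sgn_inner_eq_0_iff)
  then show ?thesis
    by (subst AE_iff_measurable[OF _ refl]) (auto simp: emeasure_eq_measure)
qed

text \<open>The half sphere \<open>\<beta> \<bullet> v < 0\<close> has mass 1/2. Up to null sets, u
  cuts it into the set in question and a wedge of mass \<open>Ang u v / (2 * pi)\<close>.\<close>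

lemma measure_unif_sphere_wedge:
  fixes u v :: "'a::euclidean_space"
  assumes "u \<noteq> 0" "v \<noteq> 0"
  shows "measure unif_sphere {\<beta>. \<beta> \<bullet> u \<le> 0 \<and> \<beta> \<bullet> v \<le> 0} = 1 / 2 - Ang u v / (2 * pi)"
proof -
  interpret prob_space "unif_sphere :: 'a measure" by (rule prob_space_unif_sphere)
  define b where "b = measure lebesgue (ball (0 :: 'a) 1)"
  have b: "0 < b" using content_ball_pos[of 1 "0 :: 'a"] by (simp add: b_def measure_completion)
  let ?L = "{\<beta>. \<beta> \<bullet> u \<le> 0 \<and> \<beta> \<bullet> v \<le> 0}"
  let ?W = "{\<beta>. \<beta> \<bullet> (- u) < 0 \<and> \<beta> \<bullet> v < 0}"
  let ?H = "{\<beta>. \<beta> \<bullet> v < 0}"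
  have "{x. norm x < 1 \<and> sgn x \<in> ?W} = wedge u v"
    unfolding mem_Collect_eq sgn_inner_less_0_iff by (auto simp: wedge_def)
  then have "measure unif_sphere ?W = Ang u v / (2 * pi)"
    using b measure_wedge[OF assms] unfolding b_def by (subst measure_unif_sphere) simp_all
  moreover have "measure unif_sphere ?H = 1 / 2"
  proof -
    have "{x. norm x < 1 \<and> x \<bullet> v < 0} = wedge (- v) (- (- v))"
      by (auto simp: wedge_def)
    then show ?thesis
      using b measure_wedge_opposite[of "- v"] assms unfolding b_def
      by (subst measure_unif_sphere) (auto simp: sgn_inner_less_0_iff)
  qed
  moreover have "measure unif_sphere ?H = measure unif_sphere (?L \<union> ?W)"
  proof (rule finite_measure_eq_AE)
    show "AE \<beta> in unif_sphere. \<beta> \<in> ?H \<longleftrightarrow> \<beta> \<in> ?L \<union> ?W"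
      using AE_unif_sphere_inner[OF assms(1)] AE_unif_sphere_inner[OF assms(2)]
      by eventually_elim (auto simp: less_le not_le)
  qed measurable
  moreover have "measure unif_sphere (?L \<union> ?W) = measure unif_sphere ?L + measure unif_sphere ?W"
    by (rule finite_measure_Union) auto
  ultimately show ?thesis by simp
qed

section \<open>The U-statistic and the V-statistic\<close>

lemma abs_sum3_le:
  fixes f g :: "'a \<Rightarrow> 'b \<Rightarrow> 'c \<Rightarrow> real"
  assumes "\<And>i k l. i \<in> I \<Longrightarrow> k \<in> K \<Longrightarrow> l \<in> L \<Longrightarrow> \<bar>f i k l\<bar> \<le> g i k l"
  shows "\<bar>\<Sum>i\<in>I. \<Sum>k\<in>K. \<Sum>l\<in>L. f i k l\<bar> \<le> (\<Sum>i\<in>I. \<Sum>k\<in>K. \<Sum>l\<in>L. g i k l)"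
  by (intro order_trans[OF sum_abs] sum_mono assms)

lemma sum3_rotate:
  "(\<Sum>i\<in>I. \<Sum>k\<in>K. \<Sum>l\<in>L. f i k l) = (\<Sum>k\<in>K. \<Sum>l\<in>L. \<Sum>i\<in>I. f i k l)"
  by (subst sum.swap, rule sum.cong[OF refl], rule sum.swap)

text \<open>Cyclic relabelling gives three equal sums whose total is 1 on distinct triples. Each of
  the three coincidences affects \<open>m\<^sup>2\<close> triples, with an error of at most 2
  because the total lies in \<open>[0, 3]\<close>.\<close>

lemma sum_triangle_same:
  fixes p :: "nat \<Rightarrow> nat \<Rightarrow> nat \<Rightarrow> real"
  assumes bnd: "\<And>k l i. 0 \<le> p k l i \<and> p k l i \<le> 1"
    and tri: "\<And>k l i. k < m \<Longrightarrow> l < m \<Longrightarrow> i < m \<Longrightarrow> k \<noteq> l \<Longrightarrow> l \<noteq> i \<Longrightarrow> i \<noteq> k \<Longrightarrow>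
      p k l i + p l i k + p i k l = 1"
  shows "\<bar>3 * (\<Sum>i<m. \<Sum>k<m. \<Sum>l<m. p k l i) - real m ^ 3\<bar> \<le> 6 * real m ^ 2"
proof -
  let ?S = "\<lambda>f. \<Sum>i<m. \<Sum>k<m. \<Sum>l<m. (f i k l :: real)"
  have "?S (\<lambda>i k l. p l i k) = ?S (\<lambda>i k l. p k l i)"
    by (rule sum3_rotate)
  moreover have "?S (\<lambda>i k l. p i k l) = ?S (\<lambda>i k l. p l i k)"
    by (rule sum3_rotate)
  ultimately have "3 * ?S (\<lambda>i k l. p k l i) - real m ^ 3 = ?S (\<lambda>i k l. p k l i + p l i k + p i k l - 1)"
    by (simp add: sum.distrib sum_subtractf power3_eq_cube)
  also have "\<bar>\<dots>\<bar> \<le> ?S (\<lambda>i k l. 2 * (of_bool (i = k) + of_bool (k = l) + of_bool (i = l)))"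
  proof (rule abs_sum3_le)
    fix i k l assume ikl: "i \<in> {..<m}" "k \<in> {..<m}" "l \<in> {..<m}"
    have bounds: "0 \<le> p k l i + p l i k + p i k l" "p k l i + p l i k + p i k l \<le> 3"
      using bnd[of k l i] bnd[of l i k] bnd[of i k l] by linarith+
    show "\<bar>p k l i + p l i k + p i k l - 1\<bar> \<le>
        2 * (of_bool (i = k) + of_bool (k = l) + of_bool (i = l))"
    proof (cases "i = k \<or> k = l \<or> i = l")
      case True
      then have "2 \<le> 2 * (of_bool (i = k) + of_bool (k = l) + of_bool (i = l) :: real)"
        by (elim disjE) simp_all
      moreover have "\<bar>p k l i + p l i k + p i k l - 1\<bar> \<le> 2"
        unfolding abs_le_iff using bounds by linarith
      ultimately show ?thesis by (rule order_trans[rotated])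
    next
      case False
      then show ?thesis using tri[of k l i] ikl by simp
    qed
  qed
  also have "\<dots> = 6 * real m ^ 2"
    by (simp add: sum.distrib of_bool_def sum.delta' sum.delta power2_eq_square flip: sum_distrib_left)
  finally show ?thesis .
qed

text \<open>Here i and k come from one sample and l from the other. Exchanging i and k identifies
  the two p-sums, so a top point sharing its sample with a competitor is traded for a top point
  alone in its sample, the only kind that occurs in U. Only \<open>i = k\<close> causes an
  error.\<close>

lemma sum_triangle_mixed:
  fixes p q :: "nat \<Rightarrow> nat \<Rightarrow> nat \<Rightarrow> real"
  assumes bnd: "\<And>k l i. 0 \<le> p k l i \<and> p k l i \<le> 1" "\<And>k l i. 0 \<le> q k l i \<and> q k l i \<le> 1"
    and tri: "\<And>k l i. k < m \<Longrightarrow> l < n \<Longrightarrow> i < m \<Longrightarrow> i \<noteq> k \<Longrightarrow>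
      p k l i + p i l k + q k i l = 1"
  shows "\<bar>2 * (\<Sum>i<m. \<Sum>k<m. \<Sum>l<n. p k l i) -
    (real m ^ 2 * n - (\<Sum>k<m. \<Sum>i<m. \<Sum>l<n. q k i l))\<bar> \<le> 2 * real m * n"
proof -
  let ?S = "\<lambda>f. \<Sum>i<m. \<Sum>k<m. \<Sum>l<n. (f i k l :: real)"
  have "?S (\<lambda>i k l. p i l k) = ?S (\<lambda>i k l. p k l i)" "?S (\<lambda>i k l. q k i l) = ?S (\<lambda>i k l. q i k l)"
    by (subst sum.swap, rule refl)+
  then have "2 * ?S (\<lambda>i k l. p k l i) - (real m ^ 2 * n - ?S (\<lambda>i k l. q i k l)) =
      ?S (\<lambda>i k l. p k l i + p i l k + q k i l - 1)"
    by (simp add: sum.distrib sum_subtractf power2_eq_square)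
  also have "\<bar>\<dots>\<bar> \<le> ?S (\<lambda>i k l. 2 * of_bool (i = k))"
  proof (rule abs_sum3_le)
    fix i k l assume ikl: "i \<in> {..<m}" "k \<in> {..<m}" "l \<in> {..<n}"
    have bounds: "0 \<le> p k l i + p i l k + q k i l" "p k l i + p i l k + q k i l \<le> 3"
      using bnd(1)[of k l i] bnd(1)[of i l k] bnd(2)[of k i l] by linarith+
    show "\<bar>p k l i + p i l k + q k i l - 1\<bar> \<le> 2 * of_bool (i = k)"
    proof (cases "i = k")
      case True
      then show ?thesis unfolding abs_le_iff using bounds by simp
    next
      case False
      then show ?thesis using tri[of k l i] ikl by simp
    qed
  qed
  also have "\<dots> = 2 * real m * n"
    by (simp add: sum.delta' sum.delta of_bool_def if_distrib flip: sum_distrib_left cong: if_cong)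
  finally show ?thesis .
qed

text \<open>The difference is the off-diagonal average divided by m, minus the diagonal sum over
  \<open>m\<^sup>2\<close>. Both lie between 0 and \<open>1 / m\<close>, so the bounds do not add
  up.\<close>

lemma off_diagonal_average:
  fixes f :: "nat \<Rightarrow> nat \<Rightarrow> real"
  assumes bnd: "\<And>i k. 0 \<le> f i k \<and> f i k \<le> 1" and m: "2 \<le> m"
  shows "\<bar>1 / (real m * (real m - 1)) * (\<Sum>i<m. \<Sum>k\<in>{..<m} - {i}. f i k) -
    1 / real m ^ 2 * (\<Sum>i<m. \<Sum>k<m. f i k)\<bar> \<le> 1 / m"
proof -
  define O' where "O' = (\<Sum>i<m. \<Sum>k\<in>{..<m} - {i}. f i k)"
  define D where "D = (\<Sum>i<m. f i i)"
  have split: "(\<Sum>i<m. \<Sum>k<m. f i k) = O' + D"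
    unfolding O'_def D_def sum.distrib[symmetric]
    by (intro sum.cong refl) (simp add: sum.remove)
  have "0 \<le> D" unfolding D_def using bnd by (intro sum_nonneg) auto
  moreover have "D \<le> (\<Sum>i<m. 1)" unfolding D_def using bnd by (intro sum_mono) auto
  ultimately have D: "0 \<le> D" "D \<le> m" by auto
  have "0 \<le> O'" unfolding O'_def using bnd by (intro sum_nonneg) auto
  moreover have "O' \<le> (\<Sum>i<m. \<Sum>k\<in>{..<m} - {i}. 1)" unfolding O'_def using bnd by (intro sum_mono) auto
  ultimately have O': "0 \<le> O'" "O' \<le> m * (real m - 1)" using m by (auto simp: of_nat_diff)
  have "1 / (real m * (real m - 1)) * O' - 1 / real m ^ 2 * (O' + D) =
      O' / (m * (real m - 1)) / m - D / real m ^ 2"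
    using m by (simp add: field_simps power2_eq_square)
  moreover have "0 \<le> O' / (m * (real m - 1)) / m" "O' / (m * (real m - 1)) / m \<le> 1 / m"
    using O' m by (auto intro!: divide_right_mono divide_nonneg_nonneg simp: pos_divide_le_eq)
  moreover have "0 \<le> D / real m ^ 2" "D / real m ^ 2 \<le> 1 / m"
    using D m by (auto simp: field_simps power2_eq_square)
  ultimately show ?thesis unfolding O'_def[symmetric] split by linarith
qed

text \<open>The signed masses of \<open>F\<^sub>m - G\<^sub>n\<close> at the pooled points; the
  absolute values are the masses of \<open>F\<^sub>m + G\<^sub>n\<close>.\<close>

definition weight :: "nat \<Rightarrow> nat \<Rightarrow> nat \<Rightarrow> real" where
  "weight m n k = (if k < m then 1 / m else - 1 / n)"

lemma sum_lessThan_add: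
  fixes f :: "nat \<Rightarrow> 'a::comm_monoid_add"
  shows "(\<Sum>i<m + n. f i) = (\<Sum>i<m. f i) + (\<Sum>j<n. f (m + j))"
  by (induction n) (auto simp: add.assoc)

lemma sum_weight:
  assumes "0 < m" "0 < n"
  shows "(\<Sum>k<m + n. weight m n k) = 0"
    and "(\<Sum>k<m + n. \<bar>weight m n k\<bar>) = 2"
    and "(\<Sum>k<m + n. (weight m n k)\<^sup>2) = 1 / m + 1 / n"
  using assms by (auto simp: sum_lessThan_add weight_def power2_eq_square field_simps)

lemma sum_weight2:
  assumes "\<And>k l. g k l = g l k"
  shows "(\<Sum>k<m + n. \<Sum>l<m + n. weight m n k * weight m n l * g k l) =
    1 / real m ^ 2 * (\<Sum>k<m. \<Sum>l<m. g k l) - 2 / (real m * real n) * (\<Sum>k<m. \<Sum>l<n. g k (m + l))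
    + 1 / real n ^ 2 * (\<Sum>k<n. \<Sum>l<n. g (m + k) (m + l))"
proof -
  have swap: "(\<Sum>k<n. \<Sum>l<m. g (m + k) l) = (\<Sum>k<m. \<Sum>l<n. g k (m + l))"
    by (subst sum.swap) (simp add: assms[of "m + _"])
  have inner: "(\<Sum>l<m + n. weight m n k * weight m n l * g k l) =
      weight m n k * (1 / m * (\<Sum>l<m. g k l)) - weight m n k * (1 / n * (\<Sum>l<n. g k (m + l)))" for k
    unfolding sum_lessThan_add by (simp add: weight_def sum_distrib_left sum_negf)
  have "(\<Sum>k<m + n. \<Sum>l<m + n. weight m n k * weight m n l * g k l) =
      1 / m * (1 / m * (\<Sum>k<m. \<Sum>l<m. g k l)) - 1 / m * (1 / n * (\<Sum>k<m. \<Sum>l<n. g k (m + l)))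
      - (1 / n * (1 / m * (\<Sum>k<n. \<Sum>l<m. g (m + k) l)) - 1 / n * (1 / n * (\<Sum>k<n. \<Sum>l<n. g (m + k) (m + l))))"
    unfolding inner unfolding sum_lessThan_add[of _ m n]
    by (simp add: weight_def sum_subtractf sum_negf sum_distrib_left)
  then show ?thesis
    unfolding swap by (simp add: power2_eq_square field_simps)
qed

text \<open>With X and Y close to 1/3, \<open>2 * C\<close> to \<open>1 - A\<close> and
  \<open>2 * E\<close> to \<open>1 - B\<close>, V is close to \<open>2 * (A + B - 2 / 3)\<close>,
  twice the main part of U. After halving V, the errors from X, C and U contribute u each, those
  from Y, E and U contribute v each.\<close>

lemma abs_combine:
  fixes A B X Y C E U V u v :: real
  assumes "\<bar>3 * X - 1\<bar> \<le> 6 * u" "\<bar>3 * Y - 1\<bar> \<le> 6 * v" "\<bar>2 * C - (1 - A)\<bar> \<le> 2 * u"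
    "\<bar>2 * E - (1 - B)\<bar> \<le> 2 * v" "\<bar>U - (A + B - 2 / 3)\<bar> \<le> u + v"
    and "V = X - 2 * C + B + A - 2 * E + Y"
  shows "\<bar>U - V / 2\<bar> \<le> 3 * (u + v)"
  unfolding assms(6)
  using assms(1-5)[THEN abs_le_D1] assms(1-5)[THEN abs_le_D2]
  by - (rule abs_leI; simp add: field_simps)

text \<open>Read \<open>a k l i\<close> as the chance that point i projects at or above both k and
  l. The inner quadratic form is then the mean of \<open>(F\<^sub>m - G\<^sub>n)\<^sup>2\<close> at
  point i, and the outer sum integrates against \<open>F\<^sub>m + G\<^sub>n\<close>.\<close>

definition V_kernel :: "nat \<Rightarrow> nat \<Rightarrow> (nat \<Rightarrow> nat \<Rightarrow> nat \<Rightarrow> real) \<Rightarrow> real" where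
  "V_kernel m n a = (\<Sum>i<m + n. \<bar>weight m n i\<bar> * (\<Sum>k<m + n. \<Sum>l<m + n. weight m n k * weight m n l * a k l i))"

text \<open>The constant is \<open>1 / 2 + 1 / 2 - 1 / 3\<close>: each angle term of
  \<open>h_CvM\<close> equals 1/2 minus a value of the kernel.\<close>

definition U_kernel :: "nat \<Rightarrow> nat \<Rightarrow> (nat \<Rightarrow> nat \<Rightarrow> nat \<Rightarrow> real) \<Rightarrow> real" where
  "U_kernel m n a = 1 / (real m * (real m - 1) * real n * (real n - 1)) *
     (\<Sum>i1<m. \<Sum>i2\<in>{..<m} - {i1}. \<Sum>j1<n. \<Sum>j2\<in>{..<n} - {j1}.
        a i1 i2 (m + j1) + a (m + j1) (m + j2) i1 - 2 / 3)"

text \<open>Each kernel term involves only three of the four indices; summing over the free one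
  multiplies it by \<open>n - 1\<close> or \<open>m - 1\<close>.\<close>

lemma U_kernel_eq:
  assumes "2 \<le> m" "2 \<le> n"
  shows "U_kernel m n a =
    1 / (real m * (real m - 1)) * (\<Sum>i<m. \<Sum>k\<in>{..<m} - {i}. (\<Sum>j<n. a i k (m + j)) / n) +
    1 / (real n * (real n - 1)) * (\<Sum>j<n. \<Sum>l\<in>{..<n} - {j}. (\<Sum>i<m. a (m + j) (m + l) i) / m) - 2 / 3"
proof -
  have card: "real (card ({..<r} - {i})) = real r - 1" if "i < r" for i r :: nat
    using that by (simp add: of_nat_diff)
  have "(\<Sum>i<m. \<Sum>k\<in>{..<m} - {i}. \<Sum>j<n. \<Sum>l\<in>{..<n} - {j}.
        a i k (m + j) + a (m + j) (m + l) i - 2 / 3) =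
     (\<Sum>i<m. \<Sum>k\<in>{..<m} - {i}. \<Sum>j<n.
        (real n - 1) * a i k (m + j) + (\<Sum>l\<in>{..<n} - {j}. a (m + j) (m + l) i) - 2 / 3 * (real n - 1))"
    by (intro sum.cong refl) (simp add: sum.distrib sum_subtractf card algebra_simps)
  also have "\<dots> = (\<Sum>i<m. (real n - 1) * (\<Sum>k\<in>{..<m} - {i}. \<Sum>j<n. a i k (m + j)) +
      (real m - 1) * (\<Sum>j<n. \<Sum>l\<in>{..<n} - {j}. a (m + j) (m + l) i) -
      2 / 3 * (real m - 1) * real n * (real n - 1))"
    by (intro sum.cong refl)
      (simp add: sum.distrib sum_subtractf card sum_distrib_left[symmetric] mult.assoc, simp add: algebra_simps)
  also have "\<dots> = (real n - 1) * (\<Sum>i<m. \<Sum>k\<in>{..<m} - {i}. \<Sum>j<n. a i k (m + j)) +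
     (real m - 1) * (\<Sum>i<m. \<Sum>j<n. \<Sum>l\<in>{..<n} - {j}. a (m + j) (m + l) i) -
     2 / 3 * (real m * (real m - 1) * real n * (real n - 1))"
    by (simp add: sum.distrib sum_subtractf sum_distrib_left[symmetric])
  finally have sum: "(\<Sum>i<m. \<Sum>k\<in>{..<m} - {i}. \<Sum>j<n. \<Sum>l\<in>{..<n} - {j}.
        a i k (m + j) + a (m + j) (m + l) i - 2 / 3) = \<dots>" .
  have aux: "1 / (p * q * r * s) * (s * x + q * y - 2 / 3 * (p * q * r * s)) =
      1 / (p * q) * (x / r) + 1 / (r * s) * (y / p) - 2 / 3"
    if "p \<noteq> 0" "q \<noteq> 0" "r \<noteq> 0" "s \<noteq> 0" for p q r s x y :: real
    using that by (simp add: field_simps)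
  have swap: "(\<Sum>i<m. \<Sum>j<n. \<Sum>l\<in>{..<n} - {j}. a (m + j) (m + l) i) =
      (\<Sum>j<n. \<Sum>l\<in>{..<n} - {j}. \<Sum>i<m. a (m + j) (m + l) i)"
    by (subst sum.swap, rule sum.cong[OF refl], rule sum.swap)
  show ?thesis
    unfolding U_kernel_def sum swap sum_divide_distrib[symmetric] by (rule aux) (use assms in auto)
qed

text \<open>Sorting the triples in V by sample gives six averages. X and Y stay inside one sample,
  in C and E the top point shares its sample with one competitor, in A and B it is alone. The
  triangle relation nearly fixes the first two and expresses the next two through the last two,
  which also make up U.\<close>

lemma U_kernel_approx:
  fixes a :: "nat \<Rightarrow> nat \<Rightarrow> nat \<Rightarrow> real"
  assumes bnd: "\<And>k l i. 0 \<le> a k l i \<and> a k l i \<le> 1" and sym: "\<And>k l i. a k l i = a l k i"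
    and tri: "\<And>k l i. k < m + n \<Longrightarrow> l < m + n \<Longrightarrow> i < m + n \<Longrightarrow> k \<noteq> l \<Longrightarrow> l \<noteq> i \<Longrightarrow> i \<noteq> k \<Longrightarrow>
      a k l i + a l i k + a i k l = 1"
    and mn: "2 \<le> m" "2 \<le> n"
  shows "\<bar>U_kernel m n a - V_kernel m n a / 2\<bar> \<le> 3 * (1 / m + 1 / n)"
proof -
  define X where "X = (\<Sum>i<m. \<Sum>k<m. \<Sum>l<m. a k l i) / real m ^ 3"
  define Y where "Y = (\<Sum>i<n. \<Sum>k<n. \<Sum>l<n. a (m + k) (m + l) (m + i)) / real n ^ 3"
  define C where "C = (\<Sum>i<m. \<Sum>k<m. \<Sum>l<n. a k (m + l) i) / (real m ^ 2 * n)"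
  define E where "E = (\<Sum>i<n. \<Sum>k<n. \<Sum>l<m. a (m + k) l (m + i)) / (real n ^ 2 * m)"
  define A where "A = (\<Sum>k<m. \<Sum>i<m. \<Sum>l<n. a k i (m + l)) / (real m ^ 2 * n)"
  define B where "B = (\<Sum>k<n. \<Sum>i<n. \<Sum>l<m. a (m + k) (m + i) l) / (real n ^ 2 * m)"
  note defs = X_def Y_def C_def E_def A_def B_def
  have scale: "\<bar>x / d - y / d\<bar> \<le> e / d" if "\<bar>x - y\<bar> \<le> e" "0 < d" for x y d e :: real
    using that by (simp add: divide_right_mono flip: diff_divide_distrib)
  have "\<bar>3 * X - 1\<bar> \<le> 6 * (1 / m)"
    using scale[OF sum_triangle_same[of a m], of "real m ^ 3"] bnd tri mn
    by (simp add: X_def power2_eq_square power3_eq_cube)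
  moreover have "\<bar>3 * Y - 1\<bar> \<le> 6 * (1 / n)"
    using scale[OF sum_triangle_same[of "\<lambda>k l i. a (m + k) (m + l) (m + i)" n], of "real n ^ 3"] bnd tri mn
    by (simp add: Y_def power2_eq_square power3_eq_cube)
  moreover have "\<bar>2 * C - (1 - A)\<bar> \<le> 2 * (1 / m)"
  proof -
    have "a k (m + l) i + a i (m + l) k + a k i (m + l) = 1" if "k < m" "l < n" "i < m" "i \<noteq> k" for k l i
      using tri[of k "m + l" i] that sym[of "m + l" i k] sym[of i k "m + l"] by simp
    from scale[OF sum_triangle_mixed[of "\<lambda>k l i. a k (m + l) i" "\<lambda>k i l. a k i (m + l)", OF _ _ this], of m n "real m ^ 2 * n"]
    show ?thesis using bnd mn by (simp add: C_def A_def power2_eq_square diff_divide_distrib)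
  qed
  moreover have "\<bar>2 * E - (1 - B)\<bar> \<le> 2 * (1 / n)"
  proof -
    have "a (m + k) l (m + i) + a (m + i) l (m + k) + a (m + k) (m + i) l = 1"
      if "k < n" "l < m" "i < n" "i \<noteq> k" for k l i
      using tri[of "m + k" l "m + i"] that sym[of l "m + i" "m + k"] sym[of "m + i" "m + k" l] by simp
    from scale[OF sum_triangle_mixed[of "\<lambda>k l i. a (m + k) l (m + i)" "\<lambda>k i l. a (m + k) (m + i) l", OF _ _ this], of n m "real n ^ 2 * m"]
    show ?thesis using bnd mn by (simp add: E_def B_def power2_eq_square diff_divide_distrib)
  qed
  moreover have "\<bar>U_kernel m n a - (A + B - 2 / 3)\<bar> \<le> 1 / m + 1 / n"
  proof -
    have avg: "0 \<le> (\<Sum>j<r. f j) / real r \<and> (\<Sum>j<r. f j) / real r \<le> 1"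
      if "0 < r" "\<And>j. 0 \<le> f j \<and> f j \<le> 1" for f :: "nat \<Rightarrow> real" and r :: nat
      using sum_mono[of "{..<r}" f "\<lambda>_. 1"] that by (auto intro!: divide_nonneg_nonneg sum_nonneg)
    have "\<bar>1 / (real m * (real m - 1)) * (\<Sum>i<m. \<Sum>k\<in>{..<m} - {i}. (\<Sum>j<n. a i k (m + j)) / n) -
      1 / real m ^ 2 * (\<Sum>i<m. \<Sum>k<m. (\<Sum>j<n. a i k (m + j)) / n)\<bar> \<le> 1 / m"
      using mn bnd by (intro off_diagonal_average avg) auto
    moreover have "\<bar>1 / (real n * (real n - 1)) * (\<Sum>j<n. \<Sum>l\<in>{..<n} - {j}. (\<Sum>i<m. a (m + j) (m + l) i) / m) -
      1 / real n ^ 2 * (\<Sum>j<n. \<Sum>l<n. (\<Sum>i<m. a (m + j) (m + l) i) / m)\<bar> \<le> 1 / n"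
      using mn bnd by (intro off_diagonal_average avg) auto
    moreover have "A = 1 / real m ^ 2 * (\<Sum>i<m. \<Sum>k<m. (\<Sum>j<n. a i k (m + j)) / n)"
      "B = 1 / real n ^ 2 * (\<Sum>j<n. \<Sum>l<n. (\<Sum>i<m. a (m + j) (m + l) i) / m)"
      by (simp_all add: A_def B_def flip: sum_divide_distrib)
    ultimately show ?thesis unfolding U_kernel_eq[OF mn] by linarith
  qed
  moreover have "V_kernel m n a = X - 2 * C + B + A - 2 * E + Y"
  proof -
    have X': "(\<Sum>i<m. \<Sum>k<m. \<Sum>l<m. a k l i) = X * real m ^ 3"
      and Y': "(\<Sum>i<n. \<Sum>k<n. \<Sum>l<n. a (m + k) (m + l) (m + i)) = Y * real n ^ 3"
      and C': "(\<Sum>i<m. \<Sum>k<m. \<Sum>l<n. a k (m + l) i) = C * (real m ^ 2 * n)"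
      using mn by (simp_all add: defs)
    have "(\<Sum>i<n. \<Sum>k<m. \<Sum>l<n. a k (m + l) (m + i)) = (\<Sum>i<n. \<Sum>k<n. \<Sum>l<m. a (m + k) l (m + i))"
      by (subst (2) sum.swap) (simp add: sym[of "m + _"])
    then have E': "(\<Sum>i<n. \<Sum>k<m. \<Sum>l<n. a k (m + l) (m + i)) = E * (real n ^ 2 * m)"
      using mn by (simp add: E_def)
    have A': "(\<Sum>i<n. \<Sum>k<m. \<Sum>l<m. a k l (m + i)) = A * (real m ^ 2 * n)"
      using mn by (subst sum3_rotate) (simp add: A_def)
    have B': "(\<Sum>i<m. \<Sum>k<n. \<Sum>l<n. a (m + k) (m + l) i) = B * (real n ^ 2 * m)"
      using mn by (subst sum3_rotate) (simp add: B_def)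
    have expand: "(\<Sum>i<r. c * (1 / real m ^ 2 * P i - 2 / (real m * real n) * Q i + 1 / real n ^ 2 * R i)) =
      c * (1 / real m ^ 2 * sum P {..<r} - 2 / (real m * real n) * sum Q {..<r} + 1 / real n ^ 2 * sum R {..<r})"
      for P Q R :: "nat \<Rightarrow> real" and c r
      by (simp only: sum.distrib sum_subtractf sum_distrib_left[symmetric])
    have "V_kernel m n a = (\<Sum>i<m. 1 / m * (\<Sum>k<m + n. \<Sum>l<m + n. weight m n k * weight m n l * a k l i)) +
      (\<Sum>i<n. 1 / n * (\<Sum>k<m + n. \<Sum>l<m + n. weight m n k * weight m n l * a k l (m + i)))"
      unfolding V_kernel_def by (subst (1) sum_lessThan_add) (simp add: weight_def)
    also have "\<dots> = 1 / m * (1 / real m ^ 2 * (X * real m ^ 3)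
        - 2 / (real m * real n) * (C * (real m ^ 2 * n)) + 1 / real n ^ 2 * (B * (real n ^ 2 * m))) +
      1 / n * (1 / real m ^ 2 * (A * (real m ^ 2 * n))
        - 2 / (real m * real n) * (E * (real n ^ 2 * m)) + 1 / real n ^ 2 * (Y * real n ^ 3))"
      unfolding sum_weight2[of "\<lambda>k l. a k l _", OF sym] expand X' Y' C' E' A' B' ..
    also have "\<dots> = X - 2 * C + B + A - 2 * E + Y"
      using mn by (simp add: power2_eq_square power3_eq_cube algebra_simps)
    finally show ?thesis .
  qed
  ultimately show ?thesis by (rule abs_combine)
qed

section \<open>The permutation critical value\<close>

text \<open>Three transpositions place k, l and i in turn; distinctness ensures that a later one
  does not move a point already placed.\<close>

lemma permutes_triple:
  assumes "{k, l, i} \<subseteq> S" "{k', l', i'} \<subseteq> S"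
    and "k \<noteq> l" "l \<noteq> i" "i \<noteq> k" "k' \<noteq> l'" "l' \<noteq> i'" "i' \<noteq> k'"
  obtains \<sigma> where "\<sigma> permutes S" "\<sigma> k = k'" "\<sigma> l = l'" "\<sigma> i = i'"
proof -
  define \<tau>1 where "\<tau>1 = Transposition.transpose k k'"
  define \<tau>2 where "\<tau>2 = Transposition.transpose (\<tau>1 l) l'"
  define \<tau>3 where "\<tau>3 = Transposition.transpose (\<tau>2 (\<tau>1 i)) i'"
  have 1: "\<tau>1 permutes S" using assms by (auto simp: \<tau>1_def intro: permutes_swap_id)
  have l1: "\<tau>1 l \<in> S" "\<tau>1 i \<in> S" using permutes_in_image[OF 1] assms by auto
  have ne1: "\<tau>1 k = k'" "\<tau>1 l \<noteq> k'" "\<tau>1 i \<noteq> k'" "\<tau>1 l \<noteq> \<tau>1 i"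
    using assms by (auto simp: \<tau>1_def Transposition.transpose_def)
  have 2: "\<tau>2 permutes S" using assms l1 by (auto simp: \<tau>2_def intro: permutes_swap_id)
  have ne2: "\<tau>2 k' = k'" "\<tau>2 (\<tau>1 l) = l'" "\<tau>2 (\<tau>1 i) \<noteq> k'" "\<tau>2 (\<tau>1 i) \<noteq> l'"
    using assms ne1 by (auto simp: \<tau>2_def Transposition.transpose_def)
  have 3: "\<tau>3 permutes S"
    using assms l1 permutes_in_image[OF 2] by (auto simp: \<tau>3_def intro: permutes_swap_id)
  have ne3: "\<tau>3 k' = k'" "\<tau>3 l' = l'" "\<tau>3 (\<tau>2 (\<tau>1 i)) = i'"
    using assms ne2 by (auto simp: \<tau>3_def Transposition.transpose_def)
  show thesis
    by (rule that[of "\<tau>3 \<circ> (\<tau>2 \<circ> \<tau>1)"])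
      (use 1 2 3 ne1 ne2 ne3 in \<open>auto intro!: permutes_compose\<close>)
qed

text \<open>As the weights sum to zero, subtracting the common value of the average over distinct
  triples leaves only the terms with coinciding indices.\<close>

lemma sum_permutations_V_kernel_le:
  fixes a :: "nat \<Rightarrow> nat \<Rightarrow> nat \<Rightarrow> real"
  assumes bnd: "\<And>k l i. 0 \<le> a k l i \<and> a k l i \<le> 1" and mn: "0 < m" "0 < n"
  shows "(\<Sum>\<pi> | \<pi> permutes {..<m + n}. V_kernel m n (\<lambda>k l i. a (\<pi> k) (\<pi> l) (\<pi> i)))
    \<le> fact (m + n) * (6 * (1 / m + 1 / n))"
proof -
  define S where "S = {..<m + n}"
  define w where "w = weight m n"
  have S: "finite S" "card S = m + n" by (auto simp: S_def)
  have cardP: "card {\<pi>. \<pi> permutes S} = fact (m + n)" by (rule card_permutations[OF S(2,1)])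
  define q where "q k l i = (\<Sum>\<pi> | \<pi> permutes S. a (\<pi> k) (\<pi> l) (\<pi> i))" for k l i
  have q0: "0 \<le> q k l i" for k l i
    unfolding q_def using bnd by (intro sum_nonneg) auto
  have q1: "q k l i \<le> fact (m + n)" for k l i
  proof -
    have "q k l i \<le> (\<Sum>\<pi> | \<pi> permutes S. 1)"
      unfolding q_def using bnd by (intro sum_mono) auto
    then show ?thesis by (simp add: cardP)
  qed
  have q_eq: "q k l i = q k' l' i'"
    if triples: "{k, l, i} \<subseteq> S" "{k', l', i'} \<subseteq> S"
      "k \<noteq> l" "l \<noteq> i" "i \<noteq> k" "k' \<noteq> l'" "l' \<noteq> i'" "i' \<noteq> k'" for k l i k' l' i'
  proof -
    obtain \<sigma> where \<sigma>: "\<sigma> permutes S" "\<sigma> k = k'" "\<sigma> l = l'" "\<sigma> i = i'"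
      using permutes_triple[OF triples] .
    show ?thesis
      unfolding q_def
      using sum_permutations_compose_right[OF \<sigma>(1), of "\<lambda>\<pi>. a (\<pi> k) (\<pi> l) (\<pi> i)"] \<sigma>(2-4)
      by simp
  qed
  obtain c where c: "0 \<le> c" "c \<le> fact (m + n)"
    and qc: "\<And>k l i. {k, l, i} \<subseteq> S \<Longrightarrow> k \<noteq> l \<Longrightarrow> l \<noteq> i \<Longrightarrow> i \<noteq> k \<Longrightarrow> q k l i = c"
  proof (cases "\<exists>k l i. {k, l, i} \<subseteq> S \<and> k \<noteq> l \<and> l \<noteq> i \<and> i \<noteq> k")
    case True
    then obtain k l i where *: "{k, l, i} \<subseteq> S" "k \<noteq> l" "l \<noteq> i" "i \<noteq> k" by blast
    show thesis by (rule that[of "q k l i"]) (use q0 q1 q_eq[OF _ *(1) _ _ _ *(2-4)] in auto)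
  next
    \<comment> \<open>With only two pooled points there is no triple of distinct indices, and any
      value in the range serves as c.\<close>
    case False
    then show thesis by (intro that[of 0]) auto
  qed
  have delta: "(\<Sum>l\<in>S. of_bool (l = i) * f l) = (f i :: real)" if "i \<in> S" for f i
  proof -
    have "(\<Sum>l\<in>S. of_bool (l = i) * f l) = (\<Sum>l\<in>S. if l = i then f l else 0)"
      by (intro sum.cong refl) auto
    then show ?thesis using that S(1) by simp
  qed
  have inner: "(\<Sum>k\<in>S. \<Sum>l\<in>S. w k * w l * q k l i) \<le>
      fact (m + n) * ((\<Sum>k\<in>S. (w k)\<^sup>2) + 2 * \<bar>w i\<bar> * (\<Sum>k\<in>S. \<bar>w k\<bar>))" if i: "i \<in> S" for i
  proof -
    have "(\<Sum>k\<in>S. \<Sum>l\<in>S. w k * w l * q k l i) =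
        (\<Sum>k\<in>S. \<Sum>l\<in>S. w k * w l * (q k l i - c)) + c * (\<Sum>k\<in>S. w k) * (\<Sum>l\<in>S. w l)"
      by (simp add: algebra_simps sum.distrib sum_subtractf sum_product sum_distrib_left)
    also have "(\<Sum>k\<in>S. w k) = 0"
      using sum_weight(1)[OF mn] by (simp add: S_def w_def)
    also have "(\<Sum>k\<in>S. \<Sum>l\<in>S. w k * w l * (q k l i - c)) \<le>
        (\<Sum>k\<in>S. \<Sum>l\<in>S. \<bar>w k\<bar> * \<bar>w l\<bar> * (fact (m + n) * (of_bool (k = l) + of_bool (l = i) + of_bool (k = i))))"
    proof (intro sum_mono)
      fix k l assume kl: "k \<in> S" "l \<in> S"
      have "\<bar>q k l i - c\<bar> \<le> fact (m + n) * (of_bool (k = l) + of_bool (l = i) + of_bool (k = i))"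
      proof (cases "k = l \<or> l = i \<or> k = i")
        case True
        then have "1 \<le> of_bool (k = l) + of_bool (l = i) + (of_bool (k = i) :: real)"
          by (elim disjE) simp_all
        then have "fact (m + n) * 1 \<le> fact (m + n) * (of_bool (k = l) + of_bool (l = i) + (of_bool (k = i) :: real))"
          by (intro mult_left_mono) auto
        moreover have "\<bar>q k l i - c\<bar> \<le> fact (m + n)"
          using q0[of k l i] q1[of k l i] c by (simp add: abs_le_iff)
        ultimately show ?thesis by linarith
      next
        case False
        then show ?thesis using qc[of k l i] kl i by simp
      qed
      then have "\<bar>w k * w l * (q k l i - c)\<bar> \<le> \<bar>w k\<bar> * \<bar>w l\<bar> * (fact (m + n) * (of_bool (k = l) + of_bool (l = i) + of_bool (k = i)))"
        unfolding abs_mult by (intro mult_left_mono) auto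
      then show "w k * w l * (q k l i - c) \<le> \<bar>w k\<bar> * \<bar>w l\<bar> * (fact (m + n) * (of_bool (k = l) + of_bool (l = i) + of_bool (k = i)))"
        by (rule order_trans[OF abs_ge_self])
    qed
    also have "\<dots> = (\<Sum>k\<in>S. fact (m + n) * ((w k)\<^sup>2 + \<bar>w i\<bar> * \<bar>w k\<bar> + of_bool (k = i) * \<bar>w k\<bar> * (\<Sum>l\<in>S. \<bar>w l\<bar>)))"
    proof (intro sum.cong refl)
      fix k assume k: "k \<in> S"
      have "(\<Sum>l\<in>S. \<bar>w k\<bar> * \<bar>w l\<bar> * (fact (m + n) * (of_bool (k = l) + of_bool (l = i) + of_bool (k = i)))) =
        fact (m + n) * ((\<Sum>l\<in>S. of_bool (k = l) * (\<bar>w k\<bar> * \<bar>w l\<bar>)) + (\<Sum>l\<in>S. of_bool (l = i) * (\<bar>w k\<bar> * \<bar>w l\<bar>)) +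
          (\<Sum>l\<in>S. of_bool (k = i) * \<bar>w k\<bar> * \<bar>w l\<bar>))"
        by (simp add: sum_distrib_left sum.distrib[symmetric] algebra_simps)
      also have "(\<Sum>l\<in>S. of_bool (k = l) * (\<bar>w k\<bar> * \<bar>w l\<bar>)) = (w k)\<^sup>2"
        using delta[OF k] by (simp add: power2_eq_square eq_commute[of k])
      also have "(\<Sum>l\<in>S. of_bool (l = i) * (\<bar>w k\<bar> * \<bar>w l\<bar>)) = \<bar>w i\<bar> * \<bar>w k\<bar>"
        using delta[OF i] by simp
      finally show "(\<Sum>l\<in>S. \<bar>w k\<bar> * \<bar>w l\<bar> * (fact (m + n) * (of_bool (k = l) + of_bool (l = i) + of_bool (k = i)))) =
        fact (m + n) * ((w k)\<^sup>2 + \<bar>w i\<bar> * \<bar>w k\<bar> + of_bool (k = i) * \<bar>w k\<bar> * (\<Sum>l\<in>S. \<bar>w l\<bar>))"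
        by (simp add: sum_distrib_left)
    qed
    also have "\<dots> = fact (m + n) * ((\<Sum>k\<in>S. (w k)\<^sup>2) + \<bar>w i\<bar> * (\<Sum>k\<in>S. \<bar>w k\<bar>) +
        (\<Sum>k\<in>S. of_bool (k = i) * \<bar>w k\<bar>) * (\<Sum>l\<in>S. \<bar>w l\<bar>))"
      by (simp only: sum_distrib_left[symmetric] sum_distrib_right[symmetric] sum.distrib)
    also have "(\<Sum>k\<in>S. of_bool (k = i) * \<bar>w k\<bar>) = \<bar>w i\<bar>"
      using delta[OF i] by simp
    finally show ?thesis by (simp add: algebra_simps)
  qed
  have "(\<Sum>\<pi> | \<pi> permutes S. V_kernel m n (\<lambda>k l i. a (\<pi> k) (\<pi> l) (\<pi> i))) =
      (\<Sum>i\<in>S. \<bar>w i\<bar> * (\<Sum>k\<in>S. \<Sum>l\<in>S. w k * w l * q k l i))"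
    unfolding V_kernel_def q_def S_def[symmetric] w_def[symmetric]
    by (simp only: sum_distrib_left sum.swap[of _ "{\<pi>. \<pi> permutes S}"])
  also have "\<dots> \<le> (\<Sum>i\<in>S. \<bar>w i\<bar> * (fact (m + n) * ((\<Sum>k\<in>S. (w k)\<^sup>2) + 2 * \<bar>w i\<bar> * (\<Sum>k\<in>S. \<bar>w k\<bar>))))"
    using inner by (intro sum_mono mult_left_mono) auto
  also have "\<dots> = (\<Sum>i\<in>S. fact (m + n) * ((\<Sum>k\<in>S. (w k)\<^sup>2) * \<bar>w i\<bar> + 2 * (\<Sum>k\<in>S. \<bar>w k\<bar>) * (w i)\<^sup>2))"
    by (intro sum.cong refl) (simp add: algebra_simps power2_eq_square)
  also have "\<dots> = fact (m + n) * ((\<Sum>k\<in>S. (w k)\<^sup>2) * (\<Sum>k\<in>S. \<bar>w k\<bar>) + 2 * (\<Sum>k\<in>S. \<bar>w k\<bar>) * (\<Sum>k\<in>S. (w k)\<^sup>2))"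
    by (simp only: sum.distrib sum_distrib_left[symmetric])
  \<comment> \<open>The pairs with \<open>k = l\<close> contribute
    \<open>2 * (1 / m + 1 / n)\<close>, those meeting i contribute
    \<open>4 * (1 / m + 1 / n)\<close>.\<close>
  also have "\<dots> = fact (m + n) * (6 * (1 / m + 1 / n))"
    using sum_weight(2,3)[OF mn] by (simp add: S_def w_def)
  finally show ?thesis by (simp add: S_def)
qed

text \<open>Markov's inequality for a uniformly drawn permutation: at most a fraction \<alpha> of
  the permuted values exceeds the threshold, which therefore belongs to the set whose infimum is the
  critical value.\<close>

lemma crit_CvM_le:
  fixes z :: "nat \<Rightarrow> 'a::euclidean_space" and V :: "(nat \<Rightarrow> 'a) \<Rightarrow> real"
  assumes \<alpha>: "0 < \<alpha>" "\<alpha> < 1"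
    and V0: "\<And>\<pi>. 0 \<le> V (\<lambda>i. z (\<pi> i))"
    and UV: "\<And>\<pi>. \<pi> permutes {..<m + n} \<Longrightarrow> U_CvM m n (\<lambda>i. z (\<pi> i)) \<le> V (\<lambda>i. z (\<pi> i)) / 2 + e"
    and V: "(\<Sum>\<pi> | \<pi> permutes {..<m + n}. V (\<lambda>i. z (\<pi> i))) \<le> fact (m + n) * b" and b: "0 < b"
  shows "crit_CvM \<alpha> m n z \<le> b / (2 * \<alpha>) + e"
  unfolding crit_CvM_def
proof (rule cInf_lower)
  let ?P = "{\<pi>. \<pi> permutes {..<m + n}}"
  let ?U = "\<lambda>\<pi>. U_CvM m n (\<lambda>i. z (\<pi> i))"
  have finP: "finite ?P" by (rule finite_permutations) simp
  have cardP: "card ?P = fact (m + n)" by (rule card_permutations) simp_all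
  let ?t = "b / (2 * \<alpha>) + e"
  have "of_bool (?t < ?U \<pi>) \<le> \<alpha> / b * V (\<lambda>i. z (\<pi> i))" if "\<pi> \<in> ?P" for \<pi>
  proof (cases "?t < ?U \<pi>")
    case True
    then have "b / (2 * \<alpha>) < V (\<lambda>i. z (\<pi> i)) / 2" using UV[of \<pi>] that by simp
    then show ?thesis using True \<alpha> b by (simp add: field_simps)
  next
    case False
    then show ?thesis using \<alpha> b V0[of \<pi>] by simp
  qed
  then have "(\<Sum>\<pi>\<in>?P. of_bool (?t < ?U \<pi>)) \<le> \<alpha> / b * (\<Sum>\<pi>\<in>?P. V (\<lambda>i. z (\<pi> i)))"
    unfolding sum_distrib_left by (rule sum_mono)
  also have "\<dots> \<le> \<alpha> / b * (fact (m + n) * b)"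
    using V \<alpha> b by (intro mult_left_mono) auto
  finally have le: "(\<Sum>\<pi>\<in>?P. of_bool (?t < ?U \<pi>)) \<le> \<alpha> * fact (m + n)"
    using b by simp
  have "(\<Sum>\<pi>\<in>?P. of_bool (?U \<pi> \<le> ?t)) = (\<Sum>\<pi>\<in>?P. 1 - of_bool (?t < ?U \<pi>) :: real)"
    by (intro sum.cong refl) (auto simp: not_less)
  also have "\<dots> \<ge> fact (m + n) - \<alpha> * fact (m + n)"
    using le by (simp add: sum_subtractf cardP)
  finally show "?t \<in> {t. 1 - \<alpha> \<le> 1 / fact (m + n) * (\<Sum>\<pi>\<in>?P. of_bool (?U \<pi> \<le> t))}"
    by (simp add: field_simps)
  \<comment> \<open>\<open>Inf\<close> on the reals is a lower bound only for sets bounded below.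
    Below the smallest permuted value the fraction is 0, short of
    \<open>1 - \<alpha>\<close>.\<close>
  show "bdd_below {t. 1 - \<alpha> \<le> 1 / fact (m + n) * (\<Sum>\<pi>\<in>?P. of_bool (?U \<pi> \<le> t))}"
  proof (rule bdd_belowI[of _ "Min (?U ` ?P)"])
    fix t assume t: "t \<in> {t. 1 - \<alpha> \<le> 1 / fact (m + n) * (\<Sum>\<pi>\<in>?P. of_bool (?U \<pi> \<le> t))}"
    show "Min (?U ` ?P) \<le> t"
    proof (rule ccontr)
      assume "\<not> Min (?U ` ?P) \<le> t"
      then have "\<not> ?U \<pi> \<le> t" if "\<pi> \<in> ?P" for \<pi>
        using Min_le[OF finite_imageI[OF finP], of "?U \<pi>" ?U] that by (auto intro: order_trans)
      then have "(\<Sum>\<pi>\<in>?P. of_bool (?U \<pi> \<le> t)) = (0 :: real)"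
        by (intro sum.neutral) auto
      then show False using t \<alpha> by simp
    qed
  qed
qed

section \<open>Projected distribution functions\<close>

lemma prob_space_distr_inner:
  fixes P :: "'a::euclidean_space measure"
  assumes "prob_space P" "sets P = sets borel"
  shows "real_distribution (distr P borel (\<lambda>x. \<beta> \<bullet> x))"
proof -
  have [measurable_cong]: "sets P = sets borel" by fact
  have "(\<lambda>x. \<beta> \<bullet> x) \<in> borel_measurable P" by measurable
  then show ?thesis
    by (intro prob_space.real_distribution_distr assms(1))
qed

lemma proj_cdf_eq:
  fixes P :: "'a::euclidean_space measure"
  assumes "prob_space P" and [measurable_cong]: "sets P = sets borel"
  shows "proj_cdf P \<beta> t = (\<integral>x. of_bool (\<beta> \<bullet> x \<le> t) \<partial>P)"
proof -
  have space: "space P = UNIV" using sets_eq_imp_space_eq[OF assms(2)] by simp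
  have "proj_cdf P \<beta> t = measure P {x. \<beta> \<bullet> x \<le> t}"
    unfolding proj_cdf_def cdf_def by (subst measure_distr) (auto simp: vimage_def space)
  also have "\<dots> = (\<integral>x. indicator {x. \<beta> \<bullet> x \<le> t} x \<partial>P)"
    by (simp add: space)
  finally show ?thesis by (simp add: indicator_def of_bool_def)
qed

lemma proj_cdf_bounds:
  fixes P :: "'a::euclidean_space measure"
  assumes "prob_space P" "sets P = sets borel"
  shows "0 \<le> proj_cdf P \<beta> t" "proj_cdf P \<beta> t \<le> 1"
proof -
  interpret real_distribution "distr P borel (\<lambda>x. \<beta> \<bullet> x)"
    using assms by (rule prob_space_distr_inner)
  show "0 \<le> proj_cdf P \<beta> t" "proj_cdf P \<beta> t \<le> 1"
    unfolding proj_cdf_def by (auto simp: cdf_nonneg cdf_bounded_prob)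
qed

text \<open>Joint measurability in direction and threshold, read off from a parametrised integral;
  the exchanges of integrals over the sphere depend on it.\<close>

lemma measurable_proj_cdf:
  fixes P :: "'a::euclidean_space measure"
  assumes "prob_space P" and sets[measurable_cong]: "sets P = sets borel"
    and [measurable]: "f \<in> borel_measurable N" "g \<in> borel_measurable N"
  shows "(\<lambda>w. proj_cdf P (f w) (g w)) \<in> borel_measurable N"
proof -
  interpret prob_space P by fact
  show ?thesis
    unfolding proj_cdf_eq[OF assms(1,2)] by measurable
qed

text \<open>The integrating measure is the law of a two-stage draw in which a coin with bias
  \<theta> selects P or Q, identified through its distribution function. Replacing both mixing
  weights by 1 gives a bound free of \<theta>.\<close>

lemma integral_interval_measure_mixture_le:
  fixes h :: "real \<Rightarrow> real"
  assumes P: "real_distribution P" and Q: "real_distribution Q" and \<theta>: "0 < \<theta>" "\<theta> < 1"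
    and [measurable]: "h \<in> borel_measurable borel" and h: "\<And>t. 0 \<le> h t" "\<And>t. h t \<le> B"
  shows "(\<integral>t. h t \<partial>interval_measure (\<lambda>t. \<theta> * cdf P t + (1 - \<theta>) * cdf Q t)) \<le>
    (\<integral>t. h t \<partial>P) + (\<integral>t. h t \<partial>Q)"
proof -
  interpret P: real_distribution P by fact
  interpret Q: real_distribution Q by fact
  define F where "F = (\<lambda>t. \<theta> * cdf P t + (1 - \<theta>) * cdf Q t)"
  define K where "K b = (if b then P else Q)" for b
  define M where "M = measure_pmf (bernoulli_pmf \<theta>) \<bind> K"
  have K: "K \<in> measurable (measure_pmf (bernoulli_pmf \<theta>)) (subprob_algebra borel)"
    by (auto simp: K_def space_subprob_algebra P.subprob_space_axioms Q.subprob_space_axioms)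
  have setsM [measurable_cong]: "sets M = sets borel"
    unfolding M_def by (rule sets_bind) (auto simp: K_def)
  have probM: "prob_space M"
    unfolding M_def
    by (rule prob_space.prob_space_bind[OF prob_space_measure_pmf _ K])
      (auto simp: K_def P.prob_space_axioms Q.prob_space_axioms)
  interpret M: prob_space M by fact
  have rdM: "real_distribution M"
    by (simp add: real_distribution_def real_distribution_axioms_def probM setsM sets_eq_imp_space_eq[OF setsM])
  have "cdf M t = F t" for t
    unfolding cdf_def M_def F_def
    by (subst subprob_space.measure_bind[OF _ K])
      (use \<theta> in \<open>auto simp: K_def measure_pmf.subprob_space_axioms\<close>)
  then have cdfM: "cdf M = F" by auto
  interpret M': real_distribution M by fact
  have mono: "F x \<le> F y" if "x \<le> y" for x y
    using M'.cdf_nondecreasing that cdfM by simp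
  have cont: "continuous (at_right a) F" for a
    using M'.cdf_is_right_cont cdfM by simp
  have lims: "(F \<longlongrightarrow> 0) at_bot" "(F \<longlongrightarrow> 1) at_top"
    using M'.cdf_lim_at_bot M'.cdf_lim_at_top_prob cdfM by auto
  have IM: "interval_measure F = M"
  proof (rule cdf_unique)
    show "real_distribution (interval_measure F)"
      by (rule real_distribution_interval_measure[OF mono cont lims])
    show "cdf (interval_measure F) = cdf M"
      using cdf_interval_measure[OF mono cont lims(1)] cdfM by simp
  qed fact
  have int: "integrable N h" if "prob_space N" "sets N = sets borel" for N
  proof -
    interpret N: prob_space N by fact
    show ?thesis
      by (rule N.integrable_const_bound[of _ B]) (use h that(2) in \<open>auto cong: measurable_cong_sets\<close>)
  qed
  have nn: "(\<integral>\<^sup>+t. h t \<partial>N) = ennreal (\<integral>t. h t \<partial>N)" if "prob_space N" "sets N = sets borel" for N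
    using int[OF that] h by (intro nn_integral_eq_integral) auto
  have nonneg: "0 \<le> (\<integral>t. h t \<partial>N)" for N using h by simp
  have "ennreal (\<integral>t. h t \<partial>M) = (\<integral>\<^sup>+t. h t \<partial>M)"
    using nn[OF probM setsM] by simp
  also have "\<dots> = (\<integral>\<^sup>+b. \<integral>\<^sup>+t. h t \<partial>K b \<partial>bernoulli_pmf \<theta>)"
    unfolding M_def by (rule nn_integral_bind[OF _ K]) simp
  also have "\<dots> = (\<integral>\<^sup>+t. h t \<partial>P) * \<theta> + (\<integral>\<^sup>+t. h t \<partial>Q) * (1 - \<theta>)"
    using \<theta> by (simp add: K_def)
  also have "\<dots> = ennreal ((\<integral>t. h t \<partial>P) * \<theta> + (\<integral>t. h t \<partial>Q) * (1 - \<theta>))"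
    using \<theta> nonneg nn[OF P.prob_space_axioms] nn[OF Q.prob_space_axioms]
    by (simp add: ennreal_mult ennreal_plus)
  finally have "(\<integral>t. h t \<partial>M) = (\<integral>t. h t \<partial>P) * \<theta> + (\<integral>t. h t \<partial>Q) * (1 - \<theta>)"
    using \<theta> nonneg by (subst (asm) ennreal_inj) auto
  also have "\<dots> \<le> (\<integral>t. h t \<partial>P) * 1 + (\<integral>t. h t \<partial>Q) * 1"
    using \<theta> nonneg by (intro add_mono mult_left_mono) auto
  finally show ?thesis using IM by (simp add: F_def)
qed

text \<open>Evaluating at the projection of a point turns the inner integral of
  \<open>W\<^sup>2\<close> into an expectation over that point, so that its empirical version is a
  sum of independent terms.\<close>

definition cdf_gap :: "'a::euclidean_space measure \<Rightarrow> 'a measure \<Rightarrow> 'a \<Rightarrow> real" where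
  "cdf_gap P Q z = (\<integral>\<beta>. (proj_cdf P \<beta> (\<beta> \<bullet> z) - proj_cdf Q \<beta> (\<beta> \<bullet> z))\<^sup>2 \<partial>unif_sphere)"

lemma sq_diff_bounds:
  fixes a b :: real
  assumes "0 \<le> a" "a \<le> 1" "0 \<le> b" "b \<le> 1"
  shows "\<bar>a - b\<bar> \<le> 1" "(a - b)\<^sup>2 \<le> 1"
proof -
  show "\<bar>a - b\<bar> \<le> 1" using assms by (simp add: abs_le_iff)
  then show "(a - b)\<^sup>2 \<le> 1" by (simp add: abs_square_le_1)
qed

context
  fixes P Q :: "'a::euclidean_space measure"
  assumes P: "prob_space P" and setsP [measurable_cong]: "sets P = sets borel"
    and Q: "prob_space Q" and setsQ [measurable_cong]: "sets Q = sets borel"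
begin

interpretation P: prob_space P by (rule P)
interpretation Q: prob_space Q by (rule Q)
interpretation S: prob_space "unif_sphere :: 'a measure" by (rule prob_space_unif_sphere)

lemmas [measurable] = measurable_proj_cdf[OF P setsP] measurable_proj_cdf[OF Q setsQ]

lemma proj_cdf_gap_le: "(proj_cdf P \<beta> t - proj_cdf Q \<beta> t)\<^sup>2 \<le> 1"
  using proj_cdf_bounds[OF P setsP] proj_cdf_bounds[OF Q setsQ] by (intro sq_diff_bounds)

lemma cdf_gap_bounds: "0 \<le> cdf_gap P Q z" "cdf_gap P Q z \<le> 1"
proof -
  show "0 \<le> cdf_gap P Q z" by (simp add: cdf_gap_def)
  show "cdf_gap P Q z \<le> 1"
    unfolding cdf_gap_def
    by (rule S.integral_le_const) (auto simp: proj_cdf_gap_le intro!: S.integrable_const_bound[of _ 1])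
qed

lemma measurable_cdf_gap [measurable]: "cdf_gap P Q \<in> borel_measurable borel"
  unfolding cdf_gap_def[abs_def] by measurable

lemma integral_cdf_gap:
  assumes M: "prob_space M" and setsM [measurable_cong]: "sets M = sets borel"
  shows "(\<integral>z. cdf_gap P Q z \<partial>M) =
      (\<integral>\<beta>. \<integral>z. (proj_cdf P \<beta> (\<beta> \<bullet> z) - proj_cdf Q \<beta> (\<beta> \<bullet> z))\<^sup>2 \<partial>M \<partial>unif_sphere)" (is ?eq)
    and "integrable unif_sphere (\<lambda>\<beta>. \<integral>z. (proj_cdf P \<beta> (\<beta> \<bullet> z) - proj_cdf Q \<beta> (\<beta> \<bullet> z))\<^sup>2 \<partial>M)" (is ?int)
proof -
  interpret M: prob_space M by fact
  interpret SM: pair_prob_space "unif_sphere :: 'a measure" M ..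
  have *: "integrable (unif_sphere \<Otimes>\<^sub>M M)
      (\<lambda>(\<beta>, z). (proj_cdf P \<beta> (\<beta> \<bullet> z) - proj_cdf Q \<beta> (\<beta> \<bullet> z))\<^sup>2)"
    by (rule SM.integrable_const_bound[of _ 1]) (auto simp: proj_cdf_gap_le)
  show ?eq unfolding cdf_gap_def by (rule SM.Fubini_integral[OF *])
  show ?int using SM.integrable_fst[OF *] by simp
qed

lemma CvM_dist_le:
  assumes \<theta>: "0 < \<theta>" "\<theta> < 1"
  shows "(CvM_dist \<theta> P Q)\<^sup>2 \<le> (\<integral>z. cdf_gap P Q z \<partial>P) + (\<integral>z. cdf_gap P Q z \<partial>Q)"
proof -
  let ?h = "\<lambda>\<beta> t. (proj_cdf P \<beta> t - proj_cdf Q \<beta> t)\<^sup>2"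
  let ?I = "\<lambda>\<beta>. \<integral>t. ?h \<beta> t \<partial>interval_measure (\<lambda>t. \<theta> * proj_cdf P \<beta> t + (1 - \<theta>) * proj_cdf Q \<beta> t)"
  let ?J = "\<lambda>\<beta>. (\<integral>z. ?h \<beta> (\<beta> \<bullet> z) \<partial>P) + (\<integral>z. ?h \<beta> (\<beta> \<bullet> z) \<partial>Q)"
  have IJ: "?I \<beta> \<le> ?J \<beta>" for \<beta>
  proof -
    have "?I \<beta> \<le> (\<integral>t. ?h \<beta> t \<partial>distr P borel (\<lambda>x. \<beta> \<bullet> x)) + (\<integral>t. ?h \<beta> t \<partial>distr Q borel (\<lambda>x. \<beta> \<bullet> x))"
      using integral_interval_measure_mixture_le[OF prob_space_distr_inner[OF P setsP, of \<beta>]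
          prob_space_distr_inner[OF Q setsQ, of \<beta>] \<theta>, of "?h \<beta>" 1] proj_cdf_gap_le[of \<beta>]
      by (auto simp: proj_cdf_def[symmetric])
    also have "\<dots> = ?J \<beta>"
      by (subst (1 2) integral_distr) auto
    finally show ?thesis .
  qed
  have "(CvM_dist \<theta> P Q)\<^sup>2 = (\<integral>\<beta>. ?I \<beta> \<partial>unif_sphere)"
    unfolding CvM_dist_def by (intro real_sqrt_pow2 integral_nonneg_AE AE_I2) auto
  \<comment> \<open>The comparison rule asks for integrability of the upper bound alone.
    Measurability of \<open>?I\<close> in \<beta> is not established here; the integral of a
    non-integrable function is 0 by convention.\<close>
  also have "\<dots> \<le> (\<integral>\<beta>. ?J \<beta> \<partial>unif_sphere)"
    using integral_cdf_gap(2)[OF P setsP] integral_cdf_gap(2)[OF Q setsQ] IJ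
    by (intro integral_mono_AE') (auto intro!: Bochner_Integration.integrable_add)
  also have "\<dots> = (\<integral>z. cdf_gap P Q z \<partial>P) + (\<integral>z. cdf_gap P Q z \<partial>Q)"
    using integral_cdf_gap[OF P setsP] integral_cdf_gap[OF Q setsQ] by simp
  finally show ?thesis .
qed

end

section \<open>The angular kernel\<close>

definition proj_le :: "'a::euclidean_space \<Rightarrow> 'a \<Rightarrow> 'a \<Rightarrow> real" where
  "proj_le \<beta> x y = of_bool (\<beta> \<bullet> x \<le> \<beta> \<bullet> y)"

lemma proj_le_bounds [simp]: "0 \<le> proj_le \<beta> x y" "proj_le \<beta> x y \<le> 1"
  by (simp_all add: proj_le_def)

lemma measurable_proj_le [measurable]:
  assumes [measurable]: "f \<in> borel_measurable N" "g \<in> borel_measurable N" "h \<in> borel_measurable N"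
  shows "(\<lambda>w. proj_le (f w) (g w) (h w)) \<in> borel_measurable N"
  unfolding proj_le_def by measurable

text \<open>Products of this kind arise when the square of an empirical distribution function is
  expanded; the wedge formula evaluates their mean over directions.\<close>

definition max_kernel :: "'a::euclidean_space \<Rightarrow> 'a \<Rightarrow> 'a \<Rightarrow> real" where
  "max_kernel x y z = (\<integral>\<beta>. proj_le \<beta> x z * proj_le \<beta> y z \<partial>unif_sphere)"

lemma integrable_unif_sphere_bounded:
  fixes f :: "'a::euclidean_space \<Rightarrow> real"
  assumes "f \<in> borel_measurable borel" "\<And>\<beta>. \<bar>f \<beta>\<bar> \<le> B"
  shows "integrable unif_sphere f"
proof -
  interpret prob_space "unif_sphere :: 'a measure" by (rule prob_space_unif_sphere)
  have "f \<in> borel_measurable unif_sphere" using assms(1) by measurable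
  then show ?thesis by (rule integrable_const_bound[rotated, of _ B]) (use assms(2) in auto)
qed

lemma proj_le_mult_bounds: "0 \<le> proj_le \<beta> x z * proj_le \<beta> y z'" "proj_le \<beta> x z * proj_le \<beta> y z' \<le> 1"
  by (auto simp: proj_le_def)

lemma integrable_proj_le_mult: "integrable unif_sphere (\<lambda>\<beta>. proj_le \<beta> x z * proj_le \<beta> y z')"
  by (rule integrable_unif_sphere_bounded[of _ 1]) (use proj_le_mult_bounds in \<open>auto simp: abs_le_iff intro: order_trans[of _ 0]\<close>)

lemma max_kernel_bounds: "0 \<le> max_kernel x y z \<and> max_kernel x y z \<le> 1"
proof
  interpret prob_space "unif_sphere :: 'a measure" by (rule prob_space_unif_sphere)
  show "0 \<le> max_kernel x y z" by (simp add: max_kernel_def proj_le_mult_bounds)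
  show "max_kernel x y z \<le> 1" unfolding max_kernel_def
    by (rule integral_le_const[OF integrable_proj_le_mult]) (simp add: proj_le_mult_bounds)
qed

lemma max_kernel_commute: "max_kernel x y z = max_kernel y x z"
  by (simp add: max_kernel_def mult.commute)

lemma max_kernel_eq_Ang:
  assumes "x \<noteq> z" "y \<noteq> z"
  shows "max_kernel x y z = 1 / 2 - Ang (x - z) (y - z) / (2 * pi)"
proof -
  have "proj_le \<beta> x z * proj_le \<beta> y z = indicator {\<beta>. \<beta> \<bullet> (x - z) \<le> 0 \<and> \<beta> \<bullet> (y - z) \<le> 0} \<beta>" for \<beta>
    by (auto simp: proj_le_def inner_diff_right)
  then have "max_kernel x y z = measure unif_sphere {\<beta>. \<beta> \<bullet> (x - z) \<le> 0 \<and> \<beta> \<bullet> (y - z) \<le> 0}"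
    by (simp add: max_kernel_def)
  then show ?thesis using measure_unif_sphere_wedge[of "x - z" "y - z"] assms by simp
qed

text \<open>Almost surely exactly one of the three projections is the largest.\<close>

lemma max_kernel_triangle:
  fixes x y z :: "'a::euclidean_space"
  assumes "x \<noteq> y" "y \<noteq> z" "z \<noteq> x"
  shows "max_kernel x y z + max_kernel y z x + max_kernel z x y = 1"
proof -
  interpret prob_space "unif_sphere :: 'a measure" by (rule prob_space_unif_sphere)
  have "max_kernel x y z + max_kernel y z x + max_kernel z x y =
      (\<integral>\<beta>. proj_le \<beta> x z * proj_le \<beta> y z + proj_le \<beta> y x * proj_le \<beta> z x + proj_le \<beta> z y * proj_le \<beta> x y \<partial>unif_sphere)"
    by (simp add: max_kernel_def integrable_proj_le_mult)
  also have "\<dots> = (\<integral>\<beta>. 1 \<partial>(unif_sphere :: 'a measure))"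
  proof (rule integral_cong_AE)
    have "x - y \<noteq> 0" "y - z \<noteq> 0" "z - x \<noteq> 0" using assms by auto
    from this[THEN AE_unif_sphere_inner]
    show "AE \<beta> in unif_sphere. proj_le \<beta> x z * proj_le \<beta> y z + proj_le \<beta> y x * proj_le \<beta> z x + proj_le \<beta> z y * proj_le \<beta> x y = 1"
      by eventually_elim (auto simp: proj_le_def inner_diff_right)
  qed measurable
  finally show ?thesis by (simp add: prob_space[unfolded space_unif_sphere])
qed

text \<open>Distinct points keep the difference vectors nonzero. At a tie \<open>Ang\<close> falls
  back to \<open>pi / 2\<close>, which disagrees with \<open>max_kernel\<close>.\<close>

lemma U_CvM_eq_U_kernel:
  assumes inj: "inj_on z {..<m + n}"
  shows "U_CvM m n z = U_kernel m n (\<lambda>k l i. max_kernel (z k) (z l) (z i))"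
  unfolding U_CvM_def U_kernel_def
proof (intro arg_cong2[where f = "(*)"] sum.cong refl)
  fix i1 i2 j1 j2
  assume ij: "i1 \<in> {..<m}" "i2 \<in> {..<m} - {i1}" "j1 \<in> {..<n}" "j2 \<in> {..<n} - {j1}"
  have "z i1 \<noteq> z (m + j1)" "z i2 \<noteq> z (m + j1)" "z (m + j2) \<noteq> z i1"
    using ij by (auto simp: inj_on_eq_iff[OF inj])
  then show "h_CvM (z i1) (z i2) (z (m + j1)) (z (m + j2)) =
      max_kernel (z i1) (z i2) (z (m + j1)) + max_kernel (z (m + j1)) (z (m + j2)) (z i1) - 2 / 3"
    by (simp add: h_CvM_def max_kernel_eq_Ang)
qed

definition V_CvM :: "nat \<Rightarrow> nat \<Rightarrow> (nat \<Rightarrow> 'a::euclidean_space) \<Rightarrow> real" where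
  "V_CvM m n z = V_kernel m n (\<lambda>k l i. max_kernel (z k) (z l) (z i))"

lemma U_V_CvM:
  assumes "inj_on z {..<m + n}" "2 \<le> m" "2 \<le> n"
  shows "\<bar>U_CvM m n z - V_CvM m n z / 2\<bar> \<le> 3 * (1 / m + 1 / n)"
  unfolding U_CvM_eq_U_kernel[OF assms(1)] V_CvM_def
proof (rule U_kernel_approx[OF max_kernel_bounds max_kernel_commute _ assms(2,3)])
  fix k l i assume "k < m + n" "l < m + n" "i < m + n" "k \<noteq> l" "l \<noteq> i" "i \<noteq> k"
  then show "max_kernel (z k) (z l) (z i) + max_kernel (z l) (z i) (z k) + max_kernel (z i) (z k) (z l) = 1"
    by (intro max_kernel_triangle) (auto simp: inj_on_eq_iff[OF assms(1)])
qed

lemma integrable_sum_proj_le_sq: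
  "integrable unif_sphere (\<lambda>\<beta>. (\<Sum>k\<in>K. w k * proj_le \<beta> (z k) x)\<^sup>2)"
proof (rule integrable_unif_sphere_bounded)
  fix \<beta>
  have "\<bar>\<Sum>k\<in>K. w k * proj_le \<beta> (z k) x\<bar> \<le> (\<Sum>k\<in>K. \<bar>w k\<bar>)"
    by (rule order_trans[OF sum_abs]) (auto intro!: sum_mono simp: abs_mult mult_left_le)
  then show "\<bar>(\<Sum>k\<in>K. w k * proj_le \<beta> (z k) x)\<^sup>2\<bar> \<le> (\<Sum>k\<in>K. \<bar>w k\<bar>)\<^sup>2"
    by (metis abs_le_square_iff abs_of_nonneg abs_power2 sum_abs_ge_zero)
qed measurable

text \<open>Undoing the expansion exhibits the quadratic form as a mean square over directions,
  which shows nonnegativity and allows the comparison with \<open>cdf_gap\<close>.\<close>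

lemma V_CvM_eq:
  "V_CvM m n z = (\<Sum>i<m + n. \<bar>weight m n i\<bar> * (\<integral>\<beta>. (\<Sum>k<m + n. weight m n k * proj_le \<beta> (z k) (z i))\<^sup>2 \<partial>unif_sphere))"
  unfolding V_CvM_def V_kernel_def
proof (intro sum.cong refl arg_cong2[where f = "(*)"])
  fix i
  have "(\<integral>\<beta>. (\<Sum>k<m + n. weight m n k * proj_le \<beta> (z k) (z i))\<^sup>2 \<partial>unif_sphere) =
    (\<integral>\<beta>. (\<Sum>k<m + n. \<Sum>l<m + n. weight m n k * weight m n l * (proj_le \<beta> (z k) (z i) * proj_le \<beta> (z l) (z i))) \<partial>unif_sphere)"
    by (intro Bochner_Integration.integral_cong refl)
      (simp add: power2_eq_square sum_product mult.assoc mult.left_commute)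
  also have "\<dots> = (\<Sum>k<m + n. \<Sum>l<m + n. weight m n k * weight m n l * max_kernel (z k) (z l) (z i))"
    by (simp add: max_kernel_def integrable_proj_le_mult)
  finally show "(\<Sum>k<m + n. \<Sum>l<m + n. weight m n k * weight m n l * max_kernel (z k) (z l) (z i)) =
    (\<integral>\<beta>. (\<Sum>k<m + n. weight m n k * proj_le \<beta> (z k) (z i))\<^sup>2 \<partial>unif_sphere)" ..
qed

lemma V_CvM_nonneg: "0 \<le> V_CvM m n z"
  unfolding V_CvM_eq by (intro sum_nonneg mult_nonneg_nonneg) auto

lemma crit_CvM_le_inj:
  assumes \<alpha>: "0 < \<alpha>" "\<alpha> < 1" and inj: "inj_on z {..<m + n}" and mn: "2 \<le> m" "2 \<le> n"
  shows "crit_CvM \<alpha> m n z \<le> (3 / \<alpha> + 3) * (1 / m + 1 / n)"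
proof -
  \<comment> \<open>The permutation mean of \<open>V_CvM\<close> is at most
    \<open>6 * (1 / m + 1 / n)\<close>, and replacing U by V/2 costs
    \<open>3 * (1 / m + 1 / n)\<close>.\<close>
  have "crit_CvM \<alpha> m n z \<le> 6 * (1 / m + 1 / n) / (2 * \<alpha>) + 3 * (1 / m + 1 / n)"
  proof (rule crit_CvM_le[OF \<alpha>, where V = "V_CvM m n"])
    fix \<pi> assume \<pi>: "\<pi> permutes {..<m + n}"
    have "inj_on (\<lambda>i. z (\<pi> i)) {..<m + n}"
      using inj \<pi> by (intro comp_inj_on[of \<pi> _ z, unfolded comp_def])
        (auto simp: permutes_image inj_on_subset[OF permutes_inj])
    from U_V_CvM[OF this mn]
    show "U_CvM m n (\<lambda>i. z (\<pi> i)) \<le> V_CvM m n (\<lambda>i. z (\<pi> i)) / 2 + 3 * (1 / m + 1 / n)"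
      by (simp add: abs_le_iff)
  next
    show "(\<Sum>\<pi> | \<pi> permutes {..<m + n}. V_CvM m n (\<lambda>i. z (\<pi> i))) \<le> fact (m + n) * (6 * (1 / m + 1 / n))"
      unfolding V_CvM_def
      using sum_permutations_V_kernel_le[of "\<lambda>k l i. max_kernel (z k) (z l) (z i)" m n] mn max_kernel_bounds by auto
    show "0 < 6 * (1 / real m + 1 / real n)" using mn by (auto intro!: add_pos_pos)
  qed (rule V_CvM_nonneg)
  also have "6 * r / (2 * \<alpha>) + 3 * r = (3 / \<alpha> + 3) * r" for r :: real
    using \<alpha> by (simp add: field_simps)
  finally show ?thesis .
qed

text \<open>The passage between U and V/2 is paid twice, once inside the critical value and once for
  the observed sample; doubling V/2 gives \<open>2 * (3 / \<alpha> + 3 + 3)\<close>.\<close>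

lemma test_CvM_eq_0_imp:
  assumes "0 < \<alpha>" "\<alpha> < 1" "inj_on z {..<m + n}" "2 \<le> m" "2 \<le> n" "test_CvM \<alpha> m n z = 0"
  shows "V_CvM m n z \<le> (6 / \<alpha> + 12) * (1 / m + 1 / n)"
proof -
  have "U_CvM m n z \<le> crit_CvM \<alpha> m n z"
    using assms(6) by (simp add: test_CvM_def split: if_splits)
  then have "V_CvM m n z / 2 \<le> (3 / \<alpha> + 3) * (1 / m + 1 / n) + 3 * (1 / m + 1 / n)"
    using crit_CvM_le_inj[OF assms(1-5)] U_V_CvM[OF assms(3-5)] by (simp add: abs_le_iff)
  then show ?thesis by (simp add: algebra_simps)
qed

section \<open>The type II error\<close>

text \<open>Pythagoras: vanishing mixed moments leave only the diagonal of the expanded square. It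
  serves both the concentration of \<open>S\<close> and the error of the empirical distribution
  functions.\<close>

lemma (in prob_space) orthogonal_sum_sq_le:
  fixes f :: "'i \<Rightarrow> 'a \<Rightarrow> real"
  assumes I: "finite I" and meas[measurable]: "\<And>k. k \<in> I \<Longrightarrow> f k \<in> borel_measurable M"
    and bnd: "\<And>k x. k \<in> I \<Longrightarrow> \<bar>f k x\<bar> \<le> B"
    and orth: "\<And>k l. k \<in> I \<Longrightarrow> l \<in> I \<Longrightarrow> k \<noteq> l \<Longrightarrow> (\<integral>x. f k x * f l x \<partial>M) = 0"
    and sq: "\<And>k. k \<in> I \<Longrightarrow> (\<integral>x. (f k x)\<^sup>2 \<partial>M) \<le> v k"
  shows "(\<integral>x. (\<Sum>k\<in>I. c k * f k x)\<^sup>2 \<partial>M) \<le> (\<Sum>k\<in>I. (c k)\<^sup>2 * v k)"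
proof -
  have int: "integrable M (\<lambda>x. f k x * f l x)" if "k \<in> I" "l \<in> I" for k l
  proof (rule integrable_const_bound[of _ "B * B"])
    show "AE x in M. norm (f k x * f l x) \<le> B * B"
      using bnd[OF that(1)] bnd[OF that(2)]
      by (intro AE_I2) (auto simp: abs_mult intro!: mult_mono intro: order_trans[OF abs_ge_zero])
  qed (use that in measurable)
  have "(\<integral>x. (\<Sum>k\<in>I. c k * f k x)\<^sup>2 \<partial>M) = (\<integral>x. (\<Sum>k\<in>I. \<Sum>l\<in>I. c k * c l * (f k x * f l x)) \<partial>M)"
    by (intro Bochner_Integration.integral_cong refl)
      (simp add: power2_eq_square sum_product mult.assoc mult.left_commute)
  also have "\<dots> = (\<Sum>k\<in>I. \<Sum>l\<in>I. c k * c l * (\<integral>x. f k x * f l x \<partial>M))"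
    using int by simp
  also have "\<dots> = (\<Sum>k\<in>I. \<Sum>l\<in>I. if l = k then (c k)\<^sup>2 * (\<integral>x. (f k x)\<^sup>2 \<partial>M) else 0)"
    using orth by (intro sum.cong refl) (auto simp: power2_eq_square)
  also have "\<dots> = (\<Sum>k\<in>I. (c k)\<^sup>2 * (\<integral>x. (f k x)\<^sup>2 \<partial>M))"
    using I by simp
  also have "\<dots> \<le> (\<Sum>k\<in>I. (c k)\<^sup>2 * v k)"
    using sq by (intro sum_mono mult_left_mono) auto
  finally show ?thesis .
qed

section \<open>Two independent samples and the empirical gap\<close>

locale two_samples =
  fixes P Q :: "'a::euclidean_space measure" and m n :: nat
  assumes prob_P: "prob_space P" and borel_P: "sets P = sets borel"
    and prob_Q: "prob_space Q" and borel_Q: "sets Q = sets borel"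
    and m_pos: "0 < m" and n_pos: "0 < n"
begin

definition marg :: "nat \<Rightarrow> 'a measure" where
  "marg k = (if k < m then P else Q)"

abbreviation "\<Omega> \<equiv> pooled_law m n P Q"

lemma pooled_law_eq: "\<Omega> = PiM {..<m + n} marg"
  by (simp add: pooled_law_def marg_def[abs_def])

lemma prob_marg: "prob_space (marg k)" and sets_marg [measurable_cong]: "sets (marg k) = sets borel"
  by (simp_all add: marg_def prob_P prob_Q borel_P borel_Q)

lemma space_marg [simp]: "space (marg k) = UNIV"
  using sets_eq_imp_space_eq[OF sets_marg] by simp

sublocale product_prob_space marg "{..<m + n}"
  by (intro product_prob_spaceI prob_marg)

sublocale pooled: prob_space \<Omega>
  unfolding pooled_law_eq by (rule P.prob_space_axioms)

sublocale sphere: prob_space "unif_sphere :: 'a measure"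
  by (rule prob_space_unif_sphere)

sublocale sphere_pooled: pair_prob_space "unif_sphere :: 'a measure" \<Omega> ..

lemma measurable_coordinate:
  assumes "k < m + n"
  shows "(\<lambda>z. z k) \<in> borel_measurable \<Omega>"
proof -
  have "(\<lambda>z. z k) \<in> measurable \<Omega> (marg k)"
    unfolding pooled_law_eq using assms by (intro measurable_component_singleton) auto
  then show ?thesis by (simp add: measurable_cong_sets[OF refl sets_marg])
qed

lemma measurable_coordinate_rev [measurable (raw)]:
  assumes "k < m + n" "f \<in> measurable borel N"
  shows "(\<lambda>z. f (z k)) \<in> measurable \<Omega> N"
  using measurable_compose[OF measurable_coordinate[OF assms(1)] assms(2)] .

lemma integral_coordinate:
  fixes g :: "'a \<Rightarrow> real"
  assumes [measurable]: "g \<in> borel_measurable borel" and i: "i < m + n"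
  shows "(\<integral>z. g (z i) \<partial>\<Omega>) = (\<integral>x. g x \<partial>marg i)"
proof -
  have "marg i = distr \<Omega> (marg i) (\<lambda>z. z i)"
    unfolding pooled_law_eq using PiM_component[of i] i by simp
  then have "(\<integral>x. g x \<partial>marg i) = (\<integral>x. g x \<partial>distr \<Omega> (marg i) (\<lambda>z. z i))"
    by simp
  also have "\<dots> = (\<integral>z. g (z i) \<partial>\<Omega>)"
  proof (rule integral_distr)
    show "(\<lambda>z. z i) \<in> measurable \<Omega> (marg i)"
      using i by (simp add: pooled_law_eq measurable_component_singleton)
  qed measurable
  finally show ?thesis ..
qed

text \<open>Fubini with coordinate i integrated first and the others frozen; both orthogonality
  arguments and the absence of ties come down to this.\<close>

lemma integral_eq_0_by_coordinate:
  fixes f :: "(nat \<Rightarrow> 'a) \<Rightarrow> real"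
  assumes i: "i < m + n" and f: "f \<in> borel_measurable \<Omega>" "\<And>z. \<bar>f z\<bar> \<le> B"
    and 0: "\<And>z. (\<integral>x. f (z(i := x)) \<partial>marg i) = 0"
  shows "(\<integral>z. f z \<partial>\<Omega>) = 0"
proof -
  have I: "insert i ({..<m + n} - {i}) = {..<m + n}" using i by auto
  have "integrable (PiM (insert i ({..<m + n} - {i})) marg) f"
    unfolding I pooled_law_eq[symmetric] by (rule pooled.integrable_const_bound[of _ B]) (use f in auto)
  from product_integral_insert[OF _ _ this]
  have "(\<integral>z. f z \<partial>\<Omega>) = (\<integral>z. (\<integral>x. f (z(i := x)) \<partial>marg i) \<partial>PiM ({..<m + n} - {i}) marg)"
    unfolding I pooled_law_eq[symmetric] by simp
  then show ?thesis by (simp add: 0)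
qed

abbreviation "\<rho> \<equiv> 1 / real m + 1 / real n"
abbreviation "w \<equiv> weight m n"
abbreviation "gap \<equiv> cdf_gap P Q"

definition T :: real where
  "T = (\<integral>z. gap z \<partial>P) + (\<integral>z. gap z \<partial>Q)"

text \<open>The counterpart of \<open>T\<close> with each law replaced by the empirical measure of
  its sample; by \<open>sum_mu\<close> its mean is \<open>T\<close>.\<close>

definition S :: "(nat \<Rightarrow> 'a) \<Rightarrow> real" where
  "S z = (\<Sum>i<m + n. \<bar>w i\<bar> * gap (z i))"

lemmas gap_bounds = cdf_gap_bounds[OF prob_P borel_P prob_Q borel_Q]

lemmas measurable_gap [measurable] = measurable_cdf_gap[OF prob_P borel_P prob_Q borel_Q]

lemma integrable_gap: "integrable (marg i) gap"
proof (rule M.integrable_const_bound[of _ 1])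
  show "gap \<in> borel_measurable (marg i)" by measurable
qed (simp add: gap_bounds)

definition mu :: "nat \<Rightarrow> real" where
  "mu i = (\<integral>x. gap x \<partial>marg i)"

lemma mu_bounds: "0 \<le> mu i" "mu i \<le> 1"
proof -
  show "0 \<le> mu i" by (simp add: mu_def gap_bounds)
  show "mu i \<le> 1" unfolding mu_def
    by (rule M.integral_le_const[OF integrable_gap]) (simp add: gap_bounds)
qed

lemma sum_mu: "(\<Sum>i<m + n. \<bar>w i\<bar> * mu i) = T"
  using m_pos n_pos by (simp add: sum_lessThan_add weight_def T_def mu_def marg_def)

lemma T_nonneg: "0 \<le> T"
  by (simp add: T_def gap_bounds)

lemma sum_sq_mu: "(\<Sum>i<m + n. \<bar>w i\<bar>\<^sup>2 * mu i) \<le> \<rho> * T"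
proof -
  have "\<bar>w i\<bar>\<^sup>2 * mu i \<le> \<rho> * (\<bar>w i\<bar> * mu i)" for i
  proof -
    have "\<bar>w i\<bar> \<le> \<rho>" by (simp add: weight_def)
    then have "\<bar>w i\<bar> * (\<bar>w i\<bar> * mu i) \<le> \<rho> * (\<bar>w i\<bar> * mu i)"
      by (rule mult_right_mono) (simp add: mu_bounds)
    then show ?thesis by (simp only: power2_eq_square mult.assoc)
  qed
  then have "(\<Sum>i<m + n. \<bar>w i\<bar>\<^sup>2 * mu i) \<le> (\<Sum>i<m + n. \<rho> * (\<bar>w i\<bar> * mu i))"
    by (intro sum_mono)
  then show ?thesis unfolding sum_distrib_left[symmetric] sum_mu .
qed

lemma measurable_S [measurable]: "S \<in> borel_measurable \<Omega>"
  unfolding S_def[abs_def] by measurable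

text \<open>Values in \<open>[0, 1]\<close> have second moment at most their mean, so the term k has
  variance at most \<open>mu k\<close>. One factor of each squared weight is bounded by
  \<open>\<rho>\<close>, the other rebuilds \<open>T\<close>.\<close>

lemma S_variance: "(\<integral>z. (S z - T)\<^sup>2 \<partial>\<Omega>) \<le> \<rho> * T"
proof -
  define f where "f k z = gap (z k) - mu k" for k and z :: "nat \<Rightarrow> 'a"
  have f_le: "\<bar>f k z\<bar> \<le> 1" for k z
    unfolding f_def by (intro sq_diff_bounds gap_bounds mu_bounds)
  have f_meas [measurable]: "f k \<in> borel_measurable \<Omega>" if "k < m + n" for k
    using that unfolding f_def by measurable
  have "S z - T = (\<Sum>i<m + n. \<bar>w i\<bar> * f i z)" for z
    by (simp add: S_def f_def sum_mu[symmetric] sum_subtractf right_diff_distrib)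
  then have "(\<integral>z. (S z - T)\<^sup>2 \<partial>\<Omega>) = (\<integral>z. (\<Sum>i<m + n. \<bar>w i\<bar> * f i z)\<^sup>2 \<partial>\<Omega>)" by simp
  also have "\<dots> \<le> (\<Sum>i<m + n. \<bar>w i\<bar>\<^sup>2 * mu i)"
  proof (rule pooled.orthogonal_sum_sq_le[where B = 1])
    fix k l assume kl: "k \<in> {..<m + n}" "l \<in> {..<m + n}" "k \<noteq> l"
    show "(\<integral>z. f k z * f l z \<partial>\<Omega>) = 0"
    proof (rule integral_eq_0_by_coordinate[of k _ 1])
      fix z :: "nat \<Rightarrow> 'a"
      have "(\<integral>x. f k (z(k := x)) * f l (z(k := x)) \<partial>marg k) = (\<integral>x. (gap x - mu k) * f l z \<partial>marg k)"
        using kl by (simp add: f_def)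
      also have "\<dots> = 0"
        using integrable_gap[of k] M.prob_space[of k, unfolded space_marg] by (simp add: mu_def)
      finally show "(\<integral>x. f k (z(k := x)) * f l (z(k := x)) \<partial>marg k) = 0" .
      show "\<bar>f k z * f l z\<bar> \<le> 1"
        unfolding abs_mult using f_le[of k z] f_le[of l z] by (intro mult_le_one) auto
    qed (use kl in \<open>auto intro!: borel_measurable_times f_meas\<close>)
  next
    fix k assume k: "k \<in> {..<m + n}"
    have "(\<integral>z. (f k z)\<^sup>2 \<partial>\<Omega>) = (\<integral>x. (gap x - mu k)\<^sup>2 \<partial>marg k)"
      unfolding f_def using k by (subst integral_coordinate[symmetric]) auto
    also have "\<dots> \<le> (\<integral>x. (1 - 2 * mu k) * gap x + (mu k)\<^sup>2 \<partial>marg k)"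
    proof (rule integral_mono_AE')
      show "integrable (marg k) (\<lambda>x. (1 - 2 * mu k) * gap x + (mu k)\<^sup>2)"
        using integrable_gap[of k] by simp
      have "(gap x)\<^sup>2 \<le> gap x" for x
        using gap_bounds[of x] by (simp add: power2_eq_square mult_left_le)
      then show "AE x in marg k. (gap x - mu k)\<^sup>2 \<le> (1 - 2 * mu k) * gap x + (mu k)\<^sup>2"
        by (simp add: power2_diff algebra_simps)
      show "AE x in marg k. 0 \<le> (1 - 2 * mu k) * gap x + (mu k)\<^sup>2"
      proof (intro AE_I2)
        fix x
        have "(gap x)\<^sup>2 \<le> gap x"
          using gap_bounds[of x] by (simp add: power2_eq_square mult_left_le)
        then have "(gap x - mu k)\<^sup>2 \<le> (1 - 2 * mu k) * gap x + (mu k)\<^sup>2"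
          by (simp add: power2_diff algebra_simps)
        then show "0 \<le> (1 - 2 * mu k) * gap x + (mu k)\<^sup>2"
          by (rule order_trans[OF zero_le_power2])
      qed
    qed
    also have "\<dots> = (1 - 2 * mu k) * mu k + (mu k)\<^sup>2"
      using integrable_gap[of k] M.prob_space[of k, unfolded space_marg] by (simp add: mu_def)
    also have "\<dots> \<le> mu k" by (simp add: power2_eq_square algebra_simps)
    finally show "(\<integral>z. (f k z)\<^sup>2 \<partial>\<Omega>) \<le> mu k" .
  qed (use f_le in \<open>auto intro: f_meas\<close>)
  also have "\<dots> \<le> \<rho> * T" by (rule sum_sq_mu)
  finally show ?thesis .
qed

end

section \<open>The error of the empirical distribution functions\<close>

context two_samples
begin

lemmas measurable_proj_cdf_marg [measurable] = measurable_proj_cdf[OF prob_marg sets_marg]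
lemmas proj_cdf_marg_bounds = proj_cdf_bounds[OF prob_marg sets_marg]

text \<open>For \<open>k \<noteq> i\<close> the subtracted value is the conditional mean given
  \<open>z i\<close>. For \<open>k = i\<close> the indicator is constantly 1, and only the bound by
  1 remains.\<close>

definition centred :: "'a \<Rightarrow> nat \<Rightarrow> nat \<Rightarrow> (nat \<Rightarrow> 'a) \<Rightarrow> real" where
  "centred \<beta> i k z = proj_le \<beta> (z k) (z i) - proj_cdf (marg k) \<beta> (\<beta> \<bullet> z i)"

text \<open>The error of \<open>F\<^sub>m - G\<^sub>n\<close> as an estimate of
  \<open>F - G\<close>, read at the projection of point i.\<close>

definition resid :: "'a \<Rightarrow> nat \<Rightarrow> (nat \<Rightarrow> 'a) \<Rightarrow> real" where
  "resid \<beta> i z = (\<Sum>k<m + n. w k * centred \<beta> i k z)"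

definition R :: "(nat \<Rightarrow> 'a) \<Rightarrow> real" where
  "R z = (\<Sum>i<m + n. \<bar>w i\<bar> * (\<integral>\<beta>. (resid \<beta> i z)\<^sup>2 \<partial>unif_sphere))"

lemma centred_le: "\<bar>centred \<beta> i k z\<bar> \<le> 1"
  unfolding centred_def by (intro sq_diff_bounds proj_le_bounds proj_cdf_marg_bounds)

lemma measurable_centred:
  assumes "i < m + n" "k < m + n"
    and [measurable]: "f \<in> borel_measurable N" "g \<in> measurable N \<Omega>"
  shows "(\<lambda>v. centred (f v) i k (g v)) \<in> borel_measurable N"
proof -
  have [measurable]: "(\<lambda>v. g v i) \<in> borel_measurable N" "(\<lambda>v. g v k) \<in> borel_measurable N"
    using measurable_compose[OF assms(4) measurable_coordinate] assms(1,2) by auto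
  show ?thesis unfolding centred_def by measurable
qed

lemma measurable_resid:
  assumes "i < m + n" "f \<in> borel_measurable N" "g \<in> measurable N \<Omega>"
  shows "(\<lambda>v. resid (f v) i (g v)) \<in> borel_measurable N"
  unfolding resid_def
  by (intro borel_measurable_sum borel_measurable_times borel_measurable_const measurable_centred)
    (use assms in auto)

lemma resid_sq_le: "(resid \<beta> i z)\<^sup>2 \<le> 4"
proof -
  have "\<bar>resid \<beta> i z\<bar> \<le> (\<Sum>k<m + n. \<bar>w k\<bar> * 1)"
    unfolding resid_def
    by (rule order_trans[OF sum_abs]) (intro sum_mono, simp add: abs_mult mult_left_le centred_le)
  then have "\<bar>resid \<beta> i z\<bar> \<le> 2" using sum_weight(2)[OF m_pos n_pos] by simp
  then have "(resid \<beta> i z)\<^sup>2 \<le> 2\<^sup>2" by (metis abs_le_square_iff abs_numeral)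
  then show ?thesis by simp
qed

text \<open>Of two distinct indices at least one differs from i, and integrating out that coordinate
  kills the mixed moment. Hence even the uncentred term \<open>k = i\<close> is orthogonal to the
  others.\<close>

lemma resid_second_moment:
  assumes i: "i < m + n"
  shows "(\<integral>z. (resid \<beta> i z)\<^sup>2 \<partial>\<Omega>) \<le> \<rho>"
proof -
  have meas: "centred \<beta> i k \<in> borel_measurable \<Omega>" if "k < m + n" for k
    using measurable_centred[OF i that, of "\<lambda>_. \<beta>" \<Omega> "\<lambda>z. z"] by simp
  have zero: "(\<integral>z. centred \<beta> i k z * centred \<beta> i l z \<partial>\<Omega>) = 0"
    if "k < m + n" "l < m + n" "k \<noteq> l" "k \<noteq> i" for k l
  proof (rule integral_eq_0_by_coordinate[of k _ 1])
    fix z :: "nat \<Rightarrow> 'a"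
    have "(\<integral>x. centred \<beta> i k (z(k := x)) * centred \<beta> i l (z(k := x)) \<partial>marg k) =
        (\<integral>x. (of_bool (\<beta> \<bullet> x \<le> \<beta> \<bullet> z i) - proj_cdf (marg k) \<beta> (\<beta> \<bullet> z i)) * centred \<beta> i l z \<partial>marg k)"
      using that by (simp add: centred_def proj_le_def)
    also have "\<dots> = (\<integral>x. of_bool (\<beta> \<bullet> x \<le> \<beta> \<bullet> z i) - proj_cdf (marg k) \<beta> (\<beta> \<bullet> z i) \<partial>marg k) * centred \<beta> i l z"
      by simp
    also have "(\<integral>x. of_bool (\<beta> \<bullet> x \<le> \<beta> \<bullet> z i) - proj_cdf (marg k) \<beta> (\<beta> \<bullet> z i) \<partial>marg k) = 0"
    proof -
      have "integrable (marg k) (\<lambda>x. of_bool (\<beta> \<bullet> x \<le> \<beta> \<bullet> z i) :: real)"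
        by (rule M.integrable_const_bound[of _ 1]) simp_all
      then show ?thesis
        using M.prob_space[of k, unfolded space_marg]
        by (simp add: proj_cdf_eq[OF prob_marg sets_marg])
    qed
    finally show "(\<integral>x. centred \<beta> i k (z(k := x)) * centred \<beta> i l (z(k := x)) \<partial>marg k) = 0"
      by (simp only: mult_zero_left)
    show "\<bar>centred \<beta> i k z * centred \<beta> i l z\<bar> \<le> 1"
      unfolding abs_mult using centred_le by (intro mult_le_one) auto
  qed (use that meas in \<open>auto intro!: borel_measurable_times\<close>)
  have "(\<integral>z. (resid \<beta> i z)\<^sup>2 \<partial>\<Omega>) \<le> (\<Sum>k<m + n. (w k)\<^sup>2 * 1)"
    unfolding resid_def
  proof (rule pooled.orthogonal_sum_sq_le[where B = 1])
    fix k l assume kl: "k \<in> {..<m + n}" "l \<in> {..<m + n}" "k \<noteq> l"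
    show "(\<integral>z. centred \<beta> i k z * centred \<beta> i l z \<partial>\<Omega>) = 0"
    proof (cases "k = i")
      case True
      then show ?thesis using zero[of l k] kl by (simp add: mult.commute)
    next
      case False
      then show ?thesis using zero[of k l] kl by simp
    qed
  next
    fix k assume k: "k \<in> {..<m + n}"
    have sq: "(centred \<beta> i k z)\<^sup>2 \<le> 1" for z
      using centred_le by (simp add: abs_square_le_1)
    have "integrable \<Omega> (\<lambda>z. (centred \<beta> i k z)\<^sup>2)"
      by (rule pooled.integrable_const_bound[of _ 1]) (use sq k meas in auto)
    then show "(\<integral>z. (centred \<beta> i k z)\<^sup>2 \<partial>\<Omega>) \<le> 1"
      by (rule pooled.integral_le_const) (simp add: sq)
  qed (use meas centred_le in auto)
  then show ?thesis using sum_weight(3)[OF m_pos n_pos] by simp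
qed

lemma integrable_resid_sq:
  assumes "i < m + n"
  shows "integrable (unif_sphere \<Otimes>\<^sub>M \<Omega>) (\<lambda>(\<beta>, z). (resid \<beta> i z)\<^sup>2)"
proof (rule sphere_pooled.integrable_const_bound[of _ 4])
  show "(\<lambda>(\<beta>, z). (resid \<beta> i z)\<^sup>2) \<in> borel_measurable (unif_sphere \<Otimes>\<^sub>M \<Omega>)"
    unfolding case_prod_beta
    by (intro borel_measurable_power measurable_resid assms) measurable
qed (simp add: case_prod_beta resid_sq_le)

lemma measurable_R [measurable]: "R \<in> borel_measurable \<Omega>"
  unfolding R_def[abs_def]
proof (intro borel_measurable_sum borel_measurable_times borel_measurable_const)
  fix i assume "i \<in> {..<m + n}"
  then have *: "integrable (unif_sphere \<Otimes>\<^sub>M \<Omega>) (\<lambda>(\<beta>, z). (resid \<beta> i z)\<^sup>2)"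
    by (intro integrable_resid_sq) simp
  show "(\<lambda>z. \<integral>\<beta>. (resid \<beta> i z)\<^sup>2 \<partial>unif_sphere) \<in> borel_measurable \<Omega>"
    using sphere_pooled.integrable_snd[OF *] by simp
qed

lemma R_nonneg: "0 \<le> R z"
  unfolding R_def by (intro sum_nonneg mult_nonneg_nonneg) auto

lemma integrable_R: "integrable \<Omega> R"
  unfolding R_def[abs_def]
proof (intro Bochner_Integration.integrable_sum integrable_mult_right)
  fix i assume "i \<in> {..<m + n}"
  then have *: "integrable (unif_sphere \<Otimes>\<^sub>M \<Omega>) (\<lambda>(\<beta>, z). (resid \<beta> i z)\<^sup>2)"
    by (intro integrable_resid_sq) simp
  show "integrable \<Omega> (\<lambda>z. \<integral>\<beta>. (resid \<beta> i z)\<^sup>2 \<partial>unif_sphere)"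
    using sphere_pooled.integrable_snd[OF *] by simp
qed

lemma expectation_R_le: "(\<integral>z. R z \<partial>\<Omega>) \<le> 2 * \<rho>"
proof -
  have int: "integrable \<Omega> (\<lambda>z. \<integral>\<beta>. (resid \<beta> i z)\<^sup>2 \<partial>unif_sphere)"
    and le: "(\<integral>z. (\<integral>\<beta>. (resid \<beta> i z)\<^sup>2 \<partial>unif_sphere) \<partial>\<Omega>) \<le> \<rho>" if i: "i < m + n" for i
  proof -
    note * = integrable_resid_sq[OF i]
    show "integrable \<Omega> (\<lambda>z. \<integral>\<beta>. (resid \<beta> i z)\<^sup>2 \<partial>unif_sphere)"
      using sphere_pooled.integrable_snd[OF *] by simp
    have "(\<integral>z. (\<integral>\<beta>. (resid \<beta> i z)\<^sup>2 \<partial>unif_sphere) \<partial>\<Omega>) = (\<integral>\<beta>. (\<integral>z. (resid \<beta> i z)\<^sup>2 \<partial>\<Omega>) \<partial>unif_sphere)"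
      by (rule sphere_pooled.Fubini_integral[OF *])
    also have "\<dots> \<le> \<rho>"
      using sphere_pooled.integrable_fst[OF *]
      by (intro sphere.integral_le_const) (auto simp: resid_second_moment[OF i])
    finally show "(\<integral>z. (\<integral>\<beta>. (resid \<beta> i z)\<^sup>2 \<partial>unif_sphere) \<partial>\<Omega>) \<le> \<rho>" .
  qed
  have "(\<integral>z. R z \<partial>\<Omega>) = (\<Sum>i<m + n. \<bar>w i\<bar> * (\<integral>z. (\<integral>\<beta>. (resid \<beta> i z)\<^sup>2 \<partial>unif_sphere) \<partial>\<Omega>))"
    unfolding R_def using int by simp
  also have "\<dots> \<le> (\<Sum>i<m + n. \<bar>w i\<bar> * \<rho>)"
    using le by (intro sum_mono mult_left_mono) auto
  also have "\<dots> = 2 * \<rho>"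
    unfolding sum_distrib_right[symmetric] sum_weight(2)[OF m_pos n_pos] ..
  finally show ?thesis .
qed

text \<open>At each pooled point the population difference is the empirical one minus
  \<open>resid\<close>; the bound \<open>(a - b)\<^sup>2 \<le> 2 * a\<^sup>2 + 2 * b\<^sup>2\<close>
  replaces the triangle inequality and avoids square roots.\<close>

lemma S_le: "S z \<le> 2 * V_CvM m n z + 2 * R z"
proof -
  have gap: "gap (z i) \<le> 2 * (\<integral>\<beta>. (\<Sum>k<m + n. w k * proj_le \<beta> (z k) (z i))\<^sup>2 \<partial>unif_sphere) +
      2 * (\<integral>\<beta>. (resid \<beta> i z)\<^sup>2 \<partial>unif_sphere)" for i
  proof -
    let ?D = "\<lambda>\<beta>. \<Sum>k<m + n. w k * proj_le \<beta> (z k) (z i)"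
    have eq: "proj_cdf P \<beta> (\<beta> \<bullet> z i) - proj_cdf Q \<beta> (\<beta> \<bullet> z i) = ?D \<beta> - resid \<beta> i z" for \<beta>
    proof -
      have "?D \<beta> - resid \<beta> i z = (\<Sum>k<m + n. w k * proj_cdf (marg k) \<beta> (\<beta> \<bullet> z i))"
        by (simp add: resid_def centred_def right_diff_distrib sum_subtractf)
      also have "\<dots> = proj_cdf P \<beta> (\<beta> \<bullet> z i) - proj_cdf Q \<beta> (\<beta> \<bullet> z i)"
        using m_pos n_pos by (simp add: sum_lessThan_add weight_def marg_def)
      finally show ?thesis ..
    qed
    have int: "integrable unif_sphere (\<lambda>\<beta>. (?D \<beta>)\<^sup>2)" by (rule integrable_sum_proj_le_sq)
    have int': "integrable unif_sphere (\<lambda>\<beta>. (resid \<beta> i z)\<^sup>2)"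
    proof (rule integrable_unif_sphere_bounded[of _ 4])
      show "(\<lambda>\<beta>. (resid \<beta> i z)\<^sup>2) \<in> borel_measurable borel"
        unfolding resid_def centred_def by measurable
    qed (simp add: resid_sq_le)
    have "gap (z i) = (\<integral>\<beta>. (?D \<beta> - resid \<beta> i z)\<^sup>2 \<partial>unif_sphere)"
      by (simp add: cdf_gap_def eq)
    also have "\<dots> \<le> (\<integral>\<beta>. 2 * (?D \<beta>)\<^sup>2 + 2 * (resid \<beta> i z)\<^sup>2 \<partial>unif_sphere)"
    proof (rule integral_mono_AE')
      show "integrable unif_sphere (\<lambda>\<beta>. 2 * (?D \<beta>)\<^sup>2 + 2 * (resid \<beta> i z)\<^sup>2)"
        using int int' by simp
      have "(a - b)\<^sup>2 \<le> 2 * a\<^sup>2 + 2 * b\<^sup>2" for a b :: real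
        using zero_le_power2[of "a + b"] by (simp add: power2_sum power2_diff)
      then show "AE \<beta> in unif_sphere. (?D \<beta> - resid \<beta> i z)\<^sup>2 \<le> 2 * (?D \<beta>)\<^sup>2 + 2 * (resid \<beta> i z)\<^sup>2"
        by simp
    qed simp
    finally show ?thesis using int int' by simp
  qed
  have "S z \<le> (\<Sum>i<m + n. \<bar>w i\<bar> * (2 * (\<integral>\<beta>. (\<Sum>k<m + n. w k * proj_le \<beta> (z k) (z i))\<^sup>2 \<partial>unif_sphere) +
      2 * (\<integral>\<beta>. (resid \<beta> i z)\<^sup>2 \<partial>unif_sphere)))"
    unfolding S_def using gap by (intro sum_mono mult_left_mono) auto
  also have "\<dots> = 2 * V_CvM m n z + 2 * R z"
    unfolding V_CvM_eq R_def sum_distrib_left sum.distrib[symmetric]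
    by (intro sum.cong refl) (simp add: algebra_simps)
  finally show ?thesis .
qed

lemma S_bounds: "0 \<le> S z" "S z \<le> 2"
proof -
  show "0 \<le> S z" unfolding S_def using gap_bounds by (intro sum_nonneg) auto
  have "S z \<le> (\<Sum>i<m + n. \<bar>w i\<bar>)"
    unfolding S_def using gap_bounds by (intro sum_mono) (simp add: mult_left_le)
  then show "S z \<le> 2" using sum_weight(2)[OF m_pos n_pos] by simp
qed

lemma T_le: "T \<le> 2"
  using mu_bounds(2)[of 0] mu_bounds(2)[of m] m_pos by (simp add: T_def mu_def marg_def)

section \<open>Tail bounds, ties and the error probability\<close>

lemma prob_S_small:
  assumes "0 < T"
  shows "measure \<Omega> {z \<in> space \<Omega>. S z \<le> T / 2} \<le> 4 * \<rho> / T"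
proof -
  have int: "integrable \<Omega> (\<lambda>z. (S z - T)\<^sup>2)"
  proof (rule pooled.integrable_const_bound[of _ "2\<^sup>2"])
    have "\<bar>S z - T\<bar> \<le> 2" for z
      using S_bounds[of z] T_nonneg T_le by (simp add: abs_le_iff)
    then have "(S z - T)\<^sup>2 \<le> 2\<^sup>2" for z by (metis abs_le_square_iff abs_numeral)
    then show "AE z in \<Omega>. norm ((S z - T)\<^sup>2) \<le> 2\<^sup>2" by simp
  qed measurable
  have "measure \<Omega> {z \<in> space \<Omega>. S z \<le> T / 2} \<le> measure \<Omega> {z \<in> space \<Omega>. (T / 2)\<^sup>2 \<le> (S z - T)\<^sup>2}"
  proof (rule pooled.finite_measure_mono)
    show "{z \<in> space \<Omega>. S z \<le> T / 2} \<subseteq> {z \<in> space \<Omega>. (T / 2)\<^sup>2 \<le> (S z - T)\<^sup>2}"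
      using assms by (auto simp: power2_commute[of _ T] intro!: power_mono)
  qed measurable
  also have "\<dots> \<le> (\<integral>z. (S z - T)\<^sup>2 \<partial>\<Omega>) / (T / 2)\<^sup>2"
    using assms by (intro integral_Markov_inequality_measure[OF int sets.empty_sets]) auto
  also have "\<dots> \<le> \<rho> * T / (T / 2)\<^sup>2"
    by (intro divide_right_mono S_variance) simp
  also have "\<rho> * T / (T / 2)\<^sup>2 = 4 * \<rho> / T"
    using assms by (simp only: power2_eq_square) (simp add: field_simps)
  finally show ?thesis .
qed

lemma prob_R_large:
  assumes "0 < T"
  shows "measure \<Omega> {z \<in> space \<Omega>. T / 8 \<le> R z} \<le> 16 * \<rho> / T"
proof -
  have "measure \<Omega> {z \<in> space \<Omega>. T / 8 \<le> R z} \<le> (\<integral>z. R z \<partial>\<Omega>) / (T / 8)"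
    using assms R_nonneg by (intro integral_Markov_inequality_measure[OF integrable_R sets.empty_sets]) auto
  also have "\<dots> \<le> (2 * \<rho>) / (T / 8)"
    using assms by (intro divide_right_mono expectation_R_le) simp
  finally show ?thesis by simp
qed

text \<open>With \<open>z j\<close> frozen, a tie means that \<open>z i\<close> hits one given
  point, which has probability zero under a law without atoms.\<close>

lemma null_ties:
  assumes atoms: "\<And>k x. measure (marg k) {x} = 0" and ij: "i < m + n" "j < m + n" "i \<noteq> j"
  shows "measure \<Omega> {z \<in> space \<Omega>. z i = z j} = 0"
proof -
  have meas: "{z \<in> space \<Omega>. z i = z j} \<in> sets \<Omega>"
    using measurable_coordinate[OF ij(1)] measurable_coordinate[OF ij(2)] by measurable
  have "(\<lambda>z. indicator {z \<in> space \<Omega>. z i = z j} z :: real) \<in> borel_measurable \<Omega>"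
    using meas by measurable
  \<comment> \<open>Dropping membership in the sample space leaves an integrand that depends on the
    coordinates i and j alone, also for functions outside the space.\<close>
  then have meas': "(\<lambda>z. of_bool (z i = z j) :: real) \<in> borel_measurable \<Omega>"
    by (rule measurable_cong[THEN iffD1, rotated]) (simp add: indicator_def)
  have "measure \<Omega> {z \<in> space \<Omega>. z i = z j} = (\<integral>z. indicator {z \<in> space \<Omega>. z i = z j} z \<partial>\<Omega>)"
    using meas by simp
  also have "\<dots> = (\<integral>z. of_bool (z i = z j) \<partial>\<Omega>)"
    by (intro Bochner_Integration.integral_cong refl) (simp add: indicator_def)
  also have "\<dots> = 0"
  proof (rule integral_eq_0_by_coordinate[OF ij(1) meas', of 1])
    fix z :: "nat \<Rightarrow> 'a"
    have "(\<integral>x. of_bool ((z(i := x)) i = (z(i := x)) j) \<partial>marg i) = (\<integral>x. indicator {z j} x \<partial>marg i)"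
      using ij by (intro Bochner_Integration.integral_cong refl) (simp add: indicator_def)
    also have "\<dots> = measure (marg i) {z j}"
      by (simp add: sets_marg)
    finally show "(\<integral>x. of_bool ((z(i := x)) i = (z(i := x)) j) \<partial>marg i) = (0 :: real)"
      using atoms by simp
  qed simp
  finally show ?thesis .
qed

text \<open>Outside the exceptional events, \<open>S > T / 2\<close> and \<open>R < T / 8\<close>,
  so \<open>S_le\<close> gives \<open>V > T / 8\<close>. Acceptance forces V down to
  \<open>(6 / \<alpha> + 12) * \<rho>\<close>, which the factor 8 in the hypothesis on c excludes.
  The constants 4 and 16 of the two tail bounds add up to 20.\<close>

lemma type2_error_le:
  assumes \<alpha>: "0 < \<alpha>" "\<alpha> < 1" and mn: "2 \<le> m" "2 \<le> n"
    and atoms: "\<And>k x. measure (marg k) {x} = 0"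
    and T: "c * \<rho> \<le> T" "8 * (6 / \<alpha> + 12) < c"
  shows "type2_error_CvM \<alpha> m n P Q \<le> ennreal (20 / c)"
proof -
  have \<rho>: "0 < \<rho>" using m_pos n_pos by (auto intro!: add_pos_pos)
  have c: "0 < c" using T(2) \<alpha> by (auto intro: le_less_trans[rotated] simp: add_nonneg_nonneg)
  have T0: "0 < T" using T(1) mult_pos_pos[OF c \<rho>] by linarith
  define ties where "ties = (\<Union>i<m + n. \<Union>j\<in>{..<m + n} - {i}. {z \<in> space \<Omega>. z i = z j})"
  let ?A = "{z \<in> space \<Omega>. S z \<le> T / 2}" and ?B = "{z \<in> space \<Omega>. T / 8 \<le> R z}"
  have tie_meas: "{z \<in> space \<Omega>. z i = z j} \<in> sets \<Omega>" if "i < m + n" "j < m + n" for i j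
    using measurable_coordinate[OF that(1)] measurable_coordinate[OF that(2)] by measurable
  have meas [measurable]: "ties \<in> sets \<Omega>" "?A \<in> sets \<Omega>" "?B \<in> sets \<Omega>"
    unfolding ties_def by (auto intro!: sets.finite_UN tie_meas)
  have "ties \<in> null_sets \<Omega>"
    unfolding ties_def
    by (intro null_sets_UN' countable_finite)
      (auto simp: null_sets_def pooled.emeasure_eq_measure null_ties[OF atoms] tie_meas)
  then have ties0: "measure \<Omega> ties = 0" by (simp add: null_sets_def measure_def)
  have sub: "{z \<in> space \<Omega>. test_CvM \<alpha> m n z = 0} \<subseteq> ties \<union> (?A \<union> ?B)"
  proof
    fix z assume z: "z \<in> {z \<in> space \<Omega>. test_CvM \<alpha> m n z = 0}"
    show "z \<in> ties \<union> (?A \<union> ?B)"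
    proof (rule ccontr)
      assume *: "z \<notin> ties \<union> (?A \<union> ?B)"
      then have "inj_on z {..<m + n}"
        using z by (auto simp: ties_def inj_on_def)
      then have "V_CvM m n z \<le> (6 / \<alpha> + 12) * \<rho>"
        using z \<alpha> mn by (intro test_CvM_eq_0_imp) auto
      moreover have "T / 2 < S z" "R z < T / 8" using * z by auto
      moreover note S_le[of z]
      ultimately have "T \<le> 8 * ((6 / \<alpha> + 12) * \<rho>)" by linarith
      also have "\<dots> < c * \<rho>" using T(2) \<rho> by (simp only: mult.assoc[symmetric] mult_strict_right_mono)
      finally show False using T(1) by simp
    qed
  qed
  have "type2_error_CvM \<alpha> m n P Q \<le> emeasure \<Omega> (ties \<union> (?A \<union> ?B))"
    unfolding type2_error_CvM_def by (intro emeasure_mono sub) measurable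
  also have "\<dots> = ennreal (measure \<Omega> (ties \<union> (?A \<union> ?B)))"
    by (rule pooled.emeasure_eq_measure)
  also have "measure \<Omega> (ties \<union> (?A \<union> ?B)) \<le> measure \<Omega> ties + (measure \<Omega> ?A + measure \<Omega> ?B)"
    using meas by (intro order_trans[OF measure_Un_le] add_left_mono measure_Un_le) auto
  also have "\<dots> \<le> 0 + (4 * \<rho> / T + 16 * \<rho> / T)"
    using prob_S_small[OF T0] prob_R_large[OF T0] ties0 by (intro add_mono) auto
  also have "\<dots> = 20 * (\<rho> / T)" by (simp only: add_divide_distrib[symmetric]) simp
  also have "\<rho> / T \<le> 1 / c" using T(1) T0 c by (simp only: pos_divide_le_eq pos_le_divide_eq) (simp add: field_simps)
  finally show ?thesis by (simp add: ennreal_leI)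
qed

end

text \<open>An atom at x would project to an atom at \<open>\<beta> \<bullet> x\<close> for every
  direction. What holds almost everywhere for a probability measure holds somewhere, and a single
  direction with continuous distribution function suffices.\<close>

lemma continuous_projections_no_atoms:
  fixes P :: "'a::euclidean_space measure"
  assumes P: "prob_space P" "sets P = sets borel" and cont: "continuous_projections P"
  shows "measure P {x} = 0"
proof -
  interpret P: prob_space P by fact
  interpret S: prob_space "unif_sphere :: 'a measure" by (rule prob_space_unif_sphere)
  have [measurable_cong]: "sets P = sets borel" by fact
  obtain \<beta> where \<beta>: "continuous_on UNIV (proj_cdf P \<beta>)"
    using cont S.AE_const[of False] unfolding continuous_projections_def
    by (metis (mono_tags, lifting) AE_cong eventually_mono)
  interpret D: real_distribution "distr P borel (\<lambda>y. \<beta> \<bullet> y)"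
    using P by (rule prob_space_distr_inner)
  have "isCont (cdf (distr P borel (\<lambda>y. \<beta> \<bullet> y))) (\<beta> \<bullet> x)"
    using \<beta> by (simp add: proj_cdf_def continuous_on_eq_continuous_at)
  then have "measure (distr P borel (\<lambda>y. \<beta> \<bullet> y)) {\<beta> \<bullet> x} = 0"
    using D.isCont_cdf by simp
  then have "measure P ((\<lambda>y. \<beta> \<bullet> y) -` {\<beta> \<bullet> x} \<inter> space P) = 0"
    by (subst (asm) measure_distr) auto
  moreover have "measure P {x} \<le> measure P ((\<lambda>y. \<beta> \<bullet> y) -` {\<beta> \<bullet> x} \<inter> space P)"
  proof (rule P.finite_measure_mono)
    show "(\<lambda>y. \<beta> \<bullet> y) -` {\<beta> \<bullet> x} \<inter> space P \<in> sets P" by measurable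
  qed (use sets_eq_imp_space_eq[OF P(2)] in auto)
  ultimately show ?thesis using measure_nonneg[of P "{x}"] by linarith
qed

theorem theorem4p2:
  fixes \<alpha> \<theta> :: real
  assumes "0 < \<alpha>" "\<alpha> < 1" and "0 < \<theta>" "\<theta> < 1"
  shows "\<exists>c0>0. \<forall>c\<ge>c0. \<exists>\<zeta>. 0 < \<zeta> \<and> \<zeta> < 1 - \<alpha> \<and>
    (\<forall>m\<ge>2. \<forall>n\<ge>2.
      (SUP (P, Q) \<in> (CvM_alternatives \<theta> (c * (1 / sqrt (real m) + 1 / sqrt (real n)))
          :: ((real ^ 'd) measure \<times> (real ^ 'd) measure) set).
        type2_error_CvM \<alpha> m n P Q) < ennreal \<zeta>)"
proof -
  \<comment> \<open>The first summand makes \<open>type2_error_le\<close> applicable, the second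
    makes \<open>20 / c\<close> less than \<open>(1 - \<alpha>) / 4\<close>. Both depend on \<alpha>
    only, not on the laws, the dimension or the sample sizes.\<close>
  define c0 where "c0 = 8 * (6 / \<alpha> + 12) + 80 / (1 - \<alpha>)"
  have c0_ge: "8 * (6 / \<alpha> + 12) < c0" "80 / (1 - \<alpha>) < c0" "1 \<le> c0"
  proof -
    have "a < a + b" "b < a + b" "1 \<le> a + b" if "96 < a" "0 < b" for a b :: real
      using that by linarith+
    moreover have "96 < 8 * (6 / \<alpha> + 12)" "0 < 80 / (1 - \<alpha>)" using assms by simp_all
    ultimately show "8 * (6 / \<alpha> + 12) < c0" "80 / (1 - \<alpha>) < c0" "1 \<le> c0"
      unfolding c0_def by blast+
  qed
  show ?thesis
  proof (rule exI[of _ c0], intro conjI allI impI)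
    show "0 < c0" using c0_ge(3) by simp
    fix c :: real assume c: "c0 \<le> c"
    show "\<exists>\<zeta>. 0 < \<zeta> \<and> \<zeta> < 1 - \<alpha> \<and> (\<forall>m\<ge>2. \<forall>n\<ge>2.
      (SUP (P, Q) \<in> (CvM_alternatives \<theta> (c * (1 / sqrt (real m) + 1 / sqrt (real n)))
          :: ((real ^ 'd) measure \<times> (real ^ 'd) measure) set).
        type2_error_CvM \<alpha> m n P Q) < ennreal \<zeta>)"
    proof (rule exI[of _ "(1 - \<alpha>) / 2"], intro conjI allI impI)
      show "0 < (1 - \<alpha>) / 2" "(1 - \<alpha>) / 2 < 1 - \<alpha>" using assms by auto
      fix m n :: nat assume mn: "2 \<le> m" "2 \<le> n"
      let ?\<epsilon> = "c * (1 / sqrt (real m) + 1 / sqrt (real n))"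
      have "type2_error_CvM \<alpha> m n P Q \<le> ennreal (20 / c)"
        if PQ: "(P, Q) \<in> CvM_alternatives \<theta> ?\<epsilon>" for P Q :: "(real ^ 'd) measure"
      proof -
        have prob_meas_P: "prob_space P" "sets P = sets borel" and prob_meas_Q: "prob_space Q" "sets Q = sets borel"
          and cP: "continuous_projections P" and cQ: "continuous_projections Q"
          and dist: "?\<epsilon> \<le> CvM_dist \<theta> P Q"
          using PQ by (auto simp: CvM_alternatives_def)
        interpret two_samples P Q m n
          by (rule two_samples.intro) (use prob_meas_P prob_meas_Q mn in auto)
        have c1: "1 \<le> c" using c c0_ge(3) by simp
        \<comment> \<open>As \<open>c \<ge> 1\<close>, one factor c can be given away, and dropping
          the cross term of the square leaves \<open>1 / m + 1 / n\<close>; the chain ends in the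
          hypothesis \<open>c * \<rho> \<le> T\<close> of \<open>type2_error_le\<close>.\<close>
        have "c * (1 / real m + 1 / real n) \<le> c\<^sup>2 * (1 / sqrt (real m) + 1 / sqrt (real n))\<^sup>2"
        proof (rule mult_mono)
          show "c \<le> c\<^sup>2" using c1 by (simp add: power2_eq_square)
          show "1 / real m + 1 / real n \<le> (1 / sqrt (real m) + 1 / sqrt (real n))\<^sup>2"
            using mn by (simp add: power2_sum power_divide)
        qed (use c1 in auto)
        also have "\<dots> = ?\<epsilon>\<^sup>2" by (simp only: power_mult_distrib)
        also have "\<dots> \<le> (CvM_dist \<theta> P Q)\<^sup>2"
          using dist c1 by (intro power_mono) (auto intro!: mult_nonneg_nonneg add_nonneg_nonneg)
        also have "\<dots> \<le> T"
          unfolding T_def by (rule CvM_dist_le[OF prob_meas_P prob_meas_Q assms(3,4)])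
        finally show ?thesis
          using assms(1,2) mn c c0_ge(1)
            continuous_projections_no_atoms[OF prob_meas_P cP] continuous_projections_no_atoms[OF prob_meas_Q cQ]
          by (intro type2_error_le) (auto simp: marg_def)
      qed
      then have "(SUP (P, Q) \<in> (CvM_alternatives \<theta> ?\<epsilon> :: ((real ^ 'd) measure \<times> (real ^ 'd) measure) set).
          type2_error_CvM \<alpha> m n P Q) \<le> ennreal (20 / c)"
        by (intro SUP_least) auto
      \<comment> \<open>A supremum inherits only a weak inequality; strictness comes from the room
        between \<open>20 / c\<close> and \<zeta>.\<close>
      also have "\<dots> < ennreal ((1 - \<alpha>) / 2)"
      proof (rule ennreal_lessI)
        have "80 / (1 - \<alpha>) < c" using c c0_ge(2) by simp
        moreover have "0 < c" using c c0_ge(3) by simp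
        ultimately have "20 / c < (1 - \<alpha>) / 4" using assms by (simp add: field_simps)
        then show "20 / c < (1 - \<alpha>) / 2" using assms by simp
      qed (use assms in simp)
      finally show "(SUP (P, Q) \<in> (CvM_alternatives \<theta> ?\<epsilon> :: ((real ^ 'd) measure \<times> (real ^ 'd) measure) set).
          type2_error_CvM \<alpha> m n P Q) < ennreal ((1 - \<alpha>) / 2)" .
    qed
  qed
qed

end
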